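(* Let $\mathcal M=\mathcal M(G;r_0,r_1,r_2)$ be a regular linear hypermap and let $H=\langle r_1,r_2\rangle$. Then one of the following holds: (1) $\mathrm{Core}_G(H)=1$; (2) $\mathrm{Core}_G(H)=\langle r_2\rangle$ and either $G\cong G_1=\mathbb Z_2\times D_{2n}=\langle r_0,r_1,r_2\mid r_0^2=r_1^2=r_2^2=1,(r_0r_1)^n=(r_2r_1)^2=(r_2r_0)^2=1\rangle$ with $n\ge3$, or $G\cong G_2=D_{2m}=\langle r_0,r_1,r_2\mid r_0^2=r_1^2=(r_0r_1)^m=1,\ r_2=(r_0r_1)^{m/2}\rangle$ with $m$ even and $m\ge 6$. Moreover: if $2n=m$ and $n$ is odd, then $G_1\cong G_2$. For regular linear hypermaps in case (2): if $n$ is even, a regular linear hypermap with automorphism group $G_1$ is isomorphic to $\mathcal M_1=\mathcal M(G_1;r_0,r_1,r_2)$; if $n$ is odd, a regular linear hypermap with automorphism group $G_1$ is isomorphic to either $\mathcal M_1=\mathcal M(G_1;r_0,r_1,r_2)$ or $\mathcal M_2=\mathcal M(G_1;r_0,r_1r_2,r_2)$; for $4\mid m$, a regular linear hypermap with automorphism group $G_2$ is isomorphic to $\mathcal M_3=\mathcal M(G_2;r_0,r_1,r_2)$. If $n$ is even, $\mathcal M_1$ is orientable with $\mathcal M$-sequence $[0;2,2,n;n,n,2;4n]$. If $n$ is odd, $\mathcal M_1$ and $\mathcal M_2$ have $\mathcal M$-sequences $[0;2,2,n;n,n,2;4n]$ and $[1;2,2,2n;n,n,1;4n]$ respectively, and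 $\mathcal M_2$ is non-orientable on the projective plane. $\mathcal M_3$ is non-orientable on the projective plane with $\mathcal M$-sequence $[1;2,2,m;\frac m2,\frac m2,1;2m]$.
   Context: Let $G$ be a finite group and $r_0,r_1,r_2\in G$ pairwise distinct involutions with $G=\langle r_0,r_1,r_2\rangle$. $\mathcal M(G;r_0,r_1,r_2)$ is a regular linear hypermap if (1) $\langle r_1,r_2\rangle\cap\langle r_0,r_2\rangle=\langle r_2\rangle$ and (2) $\langle r_1,r_2\rangle\langle r_0,r_2\rangle\cap\langle r_0,r_2\rangle\langle r_1,r_2\rangle=\langle r_1,r_2\rangle\cup\langle r_0,r_2\rangle$ (products of subsets). Its flags are the elements of $G$, with $r_i$ acting by right multiplication; its automorphism group is isomorphic to $G$. Vertices, hyperedges, hyperfaces correspond to the cosets of $\langle r_1,r_2\rangle$, $\langle r_0,r_2\rangle$, $\langle r_0,r_1\rangle$ respectively, so their numbers are $V=|G|/|\langle r_1,r_2\rangle|$, $E=|G|/|\langle r_0,r_2\rangle|$, $F=|G|/|\langle r_0,r_1\rangle|$. The type is $(k,m,n)=(|r_1r_2|,|r_0r_2|,|r_0r_1|)$ (valencies of vertices, hyperedges, hyperfaces). $\mathcal M$ is non-orientable if $G=\langle r_0r_2,r_1r_2\rangle$ and orientable otherwise; its genus $g$ is determined by $V+E+F-|G|/2=2-2g$ (orientable) or $=2-g$ (non-orientable). The $\mathcal M$-sequence is $[g;k,m,n;V,E,F;|G|]$. Two such hypermaps $\mathcal M(G;r_i)$, $\mathcal M(G';s_i)$ are isomorphic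 if there is a bijection $\sigma:G\to G'$ with $(xr_i)^\sigma=x^\sigma s_i$ for all $x,i$. $\mathrm{Core}_G(H)$ is the largest normal subgroup of $G$ contained in $H$; $D_{2n}$ is the dihedral group of order $2n$. *)

theory Defs
  imports "HOL-Algebra.Algebra"
begin

section \<open>Regular linear hypermaps\<close>

locale regular_linear_hypermap = group G for G (structure) +
  fixes r0 r1 r2
  assumes finite_carrier: "finite (carrier G)"
    and in_carrier: "r0 \<in> carrier G" "r1 \<in> carrier G" "r2 \<in> carrier G"
    and involutions: "ord r0 = 2" "ord r1 = 2" "ord r2 = 2"
    and distinct: "r0 \<noteq> r1" "r0 \<noteq> r2" "r1 \<noteq> r2"
    and generated: "carrier G = generate G {r0, r1, r2}"
    and inter: "generate G {r1, r2} \<inter> generate G {r0, r2} = generate G {r2}"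
    and linear: "(generate G {r1, r2} <#> generate G {r0, r2}) \<inter>
                 (generate G {r0, r2} <#> generate G {r1, r2})
               = generate G {r1, r2} \<union> generate G {r0, r2}"

text \<open>The flags are the elements of \<open>G\<close>, and \<open>r\<^sub>i\<close> acts on them by right multiplication.  Hence the
  orbits of \<open>\<langle>r\<^sub>1, r\<^sub>2\<rangle>\<close> etc. are left cosets.\<close>

definition vertices :: "('a, 'b) monoid_scheme \<Rightarrow> 'a \<Rightarrow> 'a \<Rightarrow> 'a \<Rightarrow> 'a set set" where
  "vertices G r0 r1 r2 = lcosets\<^bsub>G\<^esub> (generate G {r1, r2})"

definition hyperedges :: "('a, 'b) monoid_scheme \<Rightarrow> 'a \<Rightarrow> 'a \<Rightarrow> 'a \<Rightarrow> 'a set set" where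
  "hyperedges G r0 r1 r2 = lcosets\<^bsub>G\<^esub> (generate G {r0, r2})"

definition hyperfaces :: "('a, 'b) monoid_scheme \<Rightarrow> 'a \<Rightarrow> 'a \<Rightarrow> 'a \<Rightarrow> 'a set set" where
  "hyperfaces G r0 r1 r2 = lcosets\<^bsub>G\<^esub> (generate G {r0, r1})"

definition hypermap_type :: "('a, 'b) monoid_scheme \<Rightarrow> 'a \<Rightarrow> 'a \<Rightarrow> 'a \<Rightarrow> nat \<times> nat \<times> nat" where
  "hypermap_type G r0 r1 r2 =
     (group.ord G (r1 \<otimes>\<^bsub>G\<^esub> r2), group.ord G (r0 \<otimes>\<^bsub>G\<^esub> r2), group.ord G (r0 \<otimes>\<^bsub>G\<^esub> r1))"

definition non_orientable :: "('a, 'b) monoid_scheme \<Rightarrow> 'a \<Rightarrow> 'a \<Rightarrow> 'a \<Rightarrow> bool" where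
  "non_orientable G r0 r1 r2 \<longleftrightarrow> carrier G = generate G {r0 \<otimes>\<^bsub>G\<^esub> r2, r1 \<otimes>\<^bsub>G\<^esub> r2}"

abbreviation orientable :: "('a, 'b) monoid_scheme \<Rightarrow> 'a \<Rightarrow> 'a \<Rightarrow> 'a \<Rightarrow> bool" where
  "orientable G r0 r1 r2 \<equiv> \<not> non_orientable G r0 r1 r2"

definition euler_characteristic :: "('a, 'b) monoid_scheme \<Rightarrow> 'a \<Rightarrow> 'a \<Rightarrow> 'a \<Rightarrow> real" where
  "euler_characteristic G r0 r1 r2 =
     real (card (vertices G r0 r1 r2)) + real (card (hyperedges G r0 r1 r2))
     + real (card (hyperfaces G r0 r1 r2)) - real (order G) / 2"

definition genus :: "('a, 'b) monoid_scheme \<Rightarrow> 'a \<Rightarrow> 'a \<Rightarrow> 'a \<Rightarrow> nat" where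
  "genus G r0 r1 r2 = (THE g. euler_characteristic G r0 r1 r2 =
     (if orientable G r0 r1 r2 then 2 - 2 * real g else 2 - real g))"

text \<open>The projective plane is the closed non-orientable surface of genus 1.\<close>

definition on_projective_plane :: "('a, 'b) monoid_scheme \<Rightarrow> 'a \<Rightarrow> 'a \<Rightarrow> 'a \<Rightarrow> bool" where
  "on_projective_plane G r0 r1 r2 \<longleftrightarrow> non_orientable G r0 r1 r2 \<and> genus G r0 r1 r2 = 1"

definition M_sequence :: "('a, 'b) monoid_scheme \<Rightarrow> 'a \<Rightarrow> 'a \<Rightarrow> 'a \<Rightarrow>
    nat \<times> (nat \<times> nat \<times> nat) \<times> (nat \<times> nat \<times> nat) \<times> nat" where
  "M_sequence G r0 r1 r2 =
     (genus G r0 r1 r2,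
      hypermap_type G r0 r1 r2,
      (card (vertices G r0 r1 r2), card (hyperedges G r0 r1 r2), card (hyperfaces G r0 r1 r2)),
      order G)"

definition hypermap_isos :: "('a, 'b) monoid_scheme \<Rightarrow> 'a \<Rightarrow> 'a \<Rightarrow> 'a \<Rightarrow>
    ('c, 'd) monoid_scheme \<Rightarrow> 'c \<Rightarrow> 'c \<Rightarrow> 'c \<Rightarrow> ('a \<Rightarrow> 'c) set" where
  "hypermap_isos G r0 r1 r2 G' s0 s1 s2 =
     {\<sigma>. bij_betw \<sigma> (carrier G) (carrier G') \<and>
         (\<forall>x\<in>carrier G. \<sigma> (x \<otimes>\<^bsub>G\<^esub> r0) = \<sigma> x \<otimes>\<^bsub>G'\<^esub> s0 \<and>
                         \<sigma> (x \<otimes>\<^bsub>G\<^esub> r1) = \<sigma> x \<otimes>\<^bsub>G'\<^esub> s1 \<and>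
                         \<sigma> (x \<otimes>\<^bsub>G\<^esub> r2) = \<sigma> x \<otimes>\<^bsub>G'\<^esub> s2)}"

definition isomorphic_hypermaps :: "('a, 'b) monoid_scheme \<Rightarrow> 'a \<Rightarrow> 'a \<Rightarrow> 'a \<Rightarrow>
    ('c, 'd) monoid_scheme \<Rightarrow> 'c \<Rightarrow> 'c \<Rightarrow> 'c \<Rightarrow> bool" where
  "isomorphic_hypermaps G r0 r1 r2 G' s0 s1 s2 \<longleftrightarrow> hypermap_isos G r0 r1 r2 G' s0 s1 s2 \<noteq> {}"

definition hypermap_Aut :: "('a, 'b) monoid_scheme \<Rightarrow> 'a \<Rightarrow> 'a \<Rightarrow> 'a \<Rightarrow> ('a \<Rightarrow> 'a) monoid" where
  "hypermap_Aut G r0 r1 r2 =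
     BijGroup (carrier G) \<lparr>carrier := extensional (carrier G) \<inter> hypermap_isos G r0 r1 r2 G r0 r1 r2\<rparr>"

definition Core :: "('a, 'b) monoid_scheme \<Rightarrow> 'a set \<Rightarrow> 'a set" where
  "Core G H = (GREATEST N. N \<lhd> G \<and> N \<subseteq> H)"


section \<open>Dihedral groups\<close>

text \<open>The dihedral group of order \<open>2n\<close> for \<open>n \<ge> 1\<close>: the pair \<open>(a, s)\<close> stands for \<open>\<rho>\<^sup>a\<close> if \<open>s\<close> is false
  and for \<open>\<rho>\<^sup>a\<tau>\<close> if \<open>s\<close> is true, where \<open>\<rho>\<close> is a rotation of order \<open>n\<close> and \<open>\<tau>\<close> a reflection.\<close>

definition dihedral_group :: "nat \<Rightarrow> (int \<times> bool) monoid" where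
  "dihedral_group n = (let Z = integer_mod_group n in
     \<lparr>carrier = carrier Z \<times> UNIV,
      monoid.mult = (\<lambda>(a, s) (b, t). (a \<otimes>\<^bsub>Z\<^esub> (if s then inv\<^bsub>Z\<^esub> b else b), s \<noteq> t)),
      one = (\<one>\<^bsub>Z\<^esub>, False)\<rparr>)"


section \<open>Groups given by generators and relations\<close>

text \<open>A letter \<open>(i, True)\<close> is the generator \<open>x\<^sub>i\<close> and \<open>(i, False)\<close> its formal inverse.  All elements of
  the index type are generators.  A pair \<open>(u, v)\<close> in \<open>R\<close> is the relation \<open>u = v\<close>.\<close>

type_synonym 'i word = "('i \<times> bool) list"

inductive word_cong :: "('i word \<times> 'i word) set \<Rightarrow> 'i word \<Rightarrow> 'i word \<Rightarrow> bool" for R where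
  refl: "word_cong R u u"
| sym: "word_cong R u v \<Longrightarrow> word_cong R v u"
| trans: "word_cong R u v \<Longrightarrow> word_cong R v w \<Longrightarrow> word_cong R u w"
| append: "word_cong R u u' \<Longrightarrow> word_cong R v v' \<Longrightarrow> word_cong R (u @ v) (u' @ v')"
| cancel: "word_cong R [(i, b), (i, \<not> b)] []"
| relation: "(u, v) \<in> R \<Longrightarrow> word_cong R u v"

definition word_class :: "('i word \<times> 'i word) set \<Rightarrow> 'i word \<Rightarrow> 'i word set" where
  "word_class R u = {v. word_cong R u v}"

definition presented_group :: "('i word \<times> 'i word) set \<Rightarrow> 'i word set monoid" where
  "presented_group R =
     \<lparr>carrier = range (word_class R),
      monoid.mult = (\<lambda>A B. \<Union>u\<in>A. \<Union>v\<in>B. word_class R (u @ v)),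
      one = word_class R []\<rparr>"

definition word_power :: "'i word \<Rightarrow> nat \<Rightarrow> 'i word" where
  "word_power w n = concat (replicate n w)"

datatype index = I0 | I1 | I2

abbreviation x0 :: "index word" where "x0 \<equiv> [(I0, True)]"
abbreviation x1 :: "index word" where "x1 \<equiv> [(I1, True)]"
abbreviation x2 :: "index word" where "x2 \<equiv> [(I2, True)]"

definition R1 :: "nat \<Rightarrow> (index word \<times> index word) set" where
  "R1 n = {(word_power x0 2, []), (word_power x1 2, []), (word_power x2 2, []),
           (word_power (x0 @ x1) n, []), (word_power (x2 @ x1) 2, []), (word_power (x2 @ x0) 2, [])}"

definition R2 :: "nat \<Rightarrow> (index word \<times> index word) set" where
  "R2 m = {(word_power x0 2, []), (word_power x1 2, []), (word_power (x0 @ x1) m, []),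
           (x2, word_power (x0 @ x1) (m div 2))}"

abbreviation G1 :: "nat \<Rightarrow> index word set monoid" where
  "G1 n \<equiv> presented_group (R1 n)"

abbreviation G2 :: "nat \<Rightarrow> index word set monoid" where
  "G2 m \<equiv> presented_group (R2 m)"


section \<open>The three families of hypermaps\<close>

text \<open>\<open>on_M1 P n\<close> says that the predicate or function \<open>P\<close> of hypermaps is applied to
  \<open>\<M>\<^sub>1 = \<M>(G\<^sub>1; r\<^sub>0, r\<^sub>1, r\<^sub>2)\<close>; likewise for \<open>\<M>\<^sub>2 = \<M>(G\<^sub>1; r\<^sub>0, r\<^sub>1r\<^sub>2, r\<^sub>2)\<close> and
  \<open>\<M>\<^sub>3 = \<M>(G\<^sub>2; r\<^sub>0, r\<^sub>1, r\<^sub>2)\<close>.\<close>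

abbreviation on_M1 :: "(index word set monoid \<Rightarrow> index word set \<Rightarrow> index word set \<Rightarrow> index word set \<Rightarrow> 'x) \<Rightarrow> nat \<Rightarrow> 'x" where
  "on_M1 P n \<equiv> P (G1 n) (word_class (R1 n) x0) (word_class (R1 n) x1) (word_class (R1 n) x2)"

abbreviation on_M2 :: "(index word set monoid \<Rightarrow> index word set \<Rightarrow> index word set \<Rightarrow> index word set \<Rightarrow> 'x) \<Rightarrow> nat \<Rightarrow> 'x" where
  "on_M2 P n \<equiv> P (G1 n) (word_class (R1 n) x0)
     (word_class (R1 n) x1 \<otimes>\<^bsub>G1 n\<^esub> word_class (R1 n) x2) (word_class (R1 n) x2)"

abbreviation on_M3 :: "(index word set monoid \<Rightarrow> index word set \<Rightarrow> index word set \<Rightarrow> index word set \<Rightarrow> 'x) \<Rightarrow> nat \<Rightarrow> 'x" where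
  "on_M3 P m \<equiv> P (G2 m) (word_class (R2 m) x0) (word_class (R2 m) x1) (word_class (R2 m) x2)"

end

theory Submission
  imports Defs
begin

text \<open>
  Let \<open>H = \<langle>r\<^sub>1, r\<^sub>2\<rangle>\<close> and \<open>K = \<langle>r\<^sub>0, r\<^sub>2\<rangle>\<close>.  If \<open>N \<subseteq> H\<close> is normal and \<open>x \<in> N\<close>, then
  \<open>x r\<^sub>0 = r\<^sub>0 (r\<^sub>0 x r\<^sub>0)\<close> lies in \<open>HK \<inter> KH = H \<union> K\<close>, which forces \<open>x \<in> H \<inter> K = \<langle>r\<^sub>2\<rangle>\<close>.  So a
  nontrivial core is \<open>\<langle>r\<^sub>2\<rangle>\<close>, and then \<open>r\<^sub>2\<close> is central.  Let \<open>D = \<langle>r\<^sub>0, r\<^sub>1\<rangle>\<close>, which is dihedral of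
  order twice the order \<open>k\<close> of \<open>r\<^sub>0 r\<^sub>1\<close>.  Either \<open>r\<^sub>2 \<notin> D\<close> and \<open>|G| = 4k\<close>, or \<open>r\<^sub>2\<close> is the
  half turn of \<open>D = G\<close> and \<open>|G| = 2k\<close>.  The order of \<open>G\<close> thus decides between the two presentations,
  and the relations together with the order determine \<open>(G; r\<^sub>0, r\<^sub>1, r\<^sub>2)\<close> up to isomorphism.
  For odd \<open>n\<close> the triple \<open>(r\<^sub>0, r\<^sub>1 r\<^sub>2, r\<^sub>2)\<close> of \<open>G\<^sub>1\<close> falls into the second case with \<open>k = 2n\<close>; for
  even \<open>n\<close> every element of \<open>G\<^sub>1\<close> satisfies \<open>x\<^sup>n = 1\<close>, so the second case cannot occur there.
\<close>

section \<open>Presented groups\<close>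

lemma word_class_eq_iff: "word_class R u = word_class R v \<longleftrightarrow> word_cong R u v"
proof
  assume eq: "word_class R u = word_class R v"
  have "v \<in> word_class R v"
    by (simp add: word_class_def word_cong.refl)
  then have "v \<in> word_class R u" by (simp only: eq)
  then show "word_cong R u v" by (simp add: word_class_def)
next
  assume uv: "word_cong R u v"
  have "word_cong R u w \<longleftrightarrow> word_cong R v w" for w
    by (rule iffI) (rule word_cong.trans[OF word_cong.sym[OF uv]] word_cong.trans[OF uv], assumption)+
  then show "word_class R u = word_class R v"
    by (simp add: word_class_def)
qed

text \<open>The product is defined as a union over all representatives, so no choice is made;
  congruence makes the united classes equal, and the union collapses to a single class.\<close>

lemma presented_mult [simp]:
  "word_class R u \<otimes>\<^bsub>presented_group R\<^esub> word_class R v = word_class R (u @ v)"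
proof -
  have "u \<in> word_class R u" "v \<in> word_class R v"
    by (simp_all add: word_class_def word_cong.refl)
  moreover have "word_class R (u' @ v') = word_class R (u @ v)"
    if "u' \<in> word_class R u" "v' \<in> word_class R v" for u' v'
    unfolding word_class_eq_iff
    by (rule word_cong.sym, rule word_cong.append) (use that in \<open>simp_all add: word_class_def\<close>)
  ultimately have "(\<Union>u'\<in>word_class R u. \<Union>v'\<in>word_class R v. word_class R (u' @ v')) = word_class R (u @ v)"
    by blast
  then show ?thesis
    by (simp add: presented_group_def)
qed

lemma presented_carrier: "carrier (presented_group R) = range (word_class R)"
  and presented_one: "\<one>\<^bsub>presented_group R\<^esub> = word_class R []"
  by (simp_all add: presented_group_def)

lemma word_class_closed [simp]: "word_class R u \<in> carrier (presented_group R)"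
  by (simp add: presented_carrier)

text \<open>The inverse word grows at its right end: the flipped head letter meets the head of the
  word in the middle and cancels, which leaves the induction hypothesis. A left inverse is what
  \<open>groupI\<close> asks for.\<close>

lemma word_cong_left_inverse: "\<exists>v. word_cong R (v @ u) []"
proof (induction u)
  case Nil
  show ?case by (metis append_Nil2 word_cong.refl)
next
  case (Cons l u)
  then obtain v where v: "word_cong R (v @ u) []" by blast
  obtain i b where l: "l = (i, b)" by (cases l)
  have "word_cong R ([(i, \<not> b)] @ [(i, b)]) []"
    using word_cong.cancel[of R i "\<not> b"] by simp
  then have "word_cong R ((v @ ([(i, \<not> b)] @ [(i, b)])) @ u) ((v @ []) @ u)"
    by (intro word_cong.append word_cong.refl)
  then have "word_cong R ((v @ [(i, \<not> b)]) @ l # u) (v @ u)"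
    by (simp add: l)
  from word_cong.trans[OF this v] show ?case by blast
qed

lemma group_presented_group [simp]: "group (presented_group R)"
proof (rule groupI)
  fix A assume "A \<in> carrier (presented_group R)"
  then obtain u where u: "A = word_class R u" by (auto simp: presented_carrier)
  obtain v where "word_cong R (v @ u) []" using word_cong_left_inverse by blast
  then have "word_class R v \<otimes>\<^bsub>presented_group R\<^esub> A = \<one>\<^bsub>presented_group R\<^esub>"
    by (simp add: u presented_one word_class_eq_iff)
  then show "\<exists>B\<in>carrier (presented_group R). B \<otimes>\<^bsub>presented_group R\<^esub> A = \<one>\<^bsub>presented_group R\<^esub>"
    by (metis word_class_closed)
qed (auto simp: presented_carrier presented_one)

lemma word_class_power:
  "word_class R (word_power u k) = word_class R u [^]\<^bsub>presented_group R\<^esub> k"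
proof -
  interpret group "presented_group R" by simp
  show ?thesis
  proof (induction k)
    case 0
    then show ?case by (simp add: word_power_def presented_one)
  next
    case (Suc k)
    have "word_class R (word_power u (Suc k)) =
        word_class R u \<otimes>\<^bsub>presented_group R\<^esub> word_class R (word_power u k)"
      by (simp add: word_power_def)
    with Suc show ?case by (metis nat_pow_Suc2 word_class_closed)
  qed
qed

section \<open>Evaluation of words and the universal property of a presentation\<close>

definition (in group) eval_letter :: "('i \<Rightarrow> 'a) \<Rightarrow> 'i \<times> bool \<Rightarrow> 'a" where
  "eval_letter f l = (if snd l then f (fst l) else inv f (fst l))"

definition (in group) eval_word :: "('i \<Rightarrow> 'a) \<Rightarrow> 'i word \<Rightarrow> 'a" where
  "eval_word f u = foldr (\<lambda>l x. eval_letter f l \<otimes> x) u \<one>"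

context group
begin

lemma eval_letter_closed [simp]: "range f \<subseteq> carrier G \<Longrightarrow> eval_letter f l \<in> carrier G"
  by (auto simp: eval_letter_def)

lemma eval_word_simps [simp]:
  "eval_word f [] = \<one>"
  "eval_word f (l # u) = eval_letter f l \<otimes> eval_word f u"
  by (simp_all add: eval_word_def)

lemma eval_word_closed [simp]: "range f \<subseteq> carrier G \<Longrightarrow> eval_word f u \<in> carrier G"
  by (induction u) auto

lemma eval_word_append [simp]:
  "range f \<subseteq> carrier G \<Longrightarrow> eval_word f (u @ v) = eval_word f u \<otimes> eval_word f v"
  by (induction u) (auto simp: m_assoc)

lemma eval_word_power:
  "range f \<subseteq> carrier G \<Longrightarrow> eval_word f (word_power u k) = eval_word f u [^] k"
proof (induction k)
  case 0
  then show ?case by (simp add: word_power_def)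
next
  case (Suc k)
  then have "eval_word f (word_power u (Suc k)) = eval_word f u \<otimes> eval_word f u [^] k"
    by (simp add: word_power_def)
  with Suc.prems show ?case by (metis nat_pow_Suc2 eval_word_closed)
qed

lemma eval_word_cong:
  assumes "word_cong R u v" "range f \<subseteq> carrier G"
    and "\<And>u v. (u, v) \<in> R \<Longrightarrow> eval_word f u = eval_word f v"
  shows "eval_word f u = eval_word f v"
  using assms(1)
proof (induction rule: word_cong.induct)
  case (cancel i b)
  then show ?case using assms(2) by (auto simp: eval_letter_def image_subset_iff)
next
  case (relation u v)
  then show ?case by (rule assms(3))
qed (use assms(2) in simp_all)

text \<open>Von Dyck's principle: images that satisfy the relations extend to a homomorphism. This
  is how presented groups are mapped onto concrete ones.\<close>

lemma presented_group_hom: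
  assumes f: "range f \<subseteq> carrier G"
    and R: "\<And>u v. (u, v) \<in> R \<Longrightarrow> eval_word f u = eval_word f v"
  obtains h where "h \<in> hom (presented_group R) G"
    and "\<And>u. h (word_class R u) = eval_word f u"
proof -
  \<comment> \<open>\<open>SOME\<close> picks an arbitrary representative; by
    \<open>eval_word_cong\<close> the value is constant on a class, so the choice does not
    matter.\<close>
  define h where "h A = eval_word f (SOME u. u \<in> A)" for A
  have h: "h (word_class R u) = eval_word f u" for u
  proof -
    have "u \<in> word_class R u" by (simp add: word_class_def word_cong.refl)
    then have "(SOME v. v \<in> word_class R u) \<in> word_class R u" by (rule someI)
    then have "word_cong R u (SOME v. v \<in> word_class R u)"
      by (simp add: word_class_def)
    then have "eval_word f u = eval_word f (SOME v. v \<in> word_class R u)"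
      using f R by (rule eval_word_cong)
    then show ?thesis by (simp only: h_def)
  qed
  have "h \<in> hom (presented_group R) G"
  proof (rule homI)
    fix A B assume "A \<in> carrier (presented_group R)" "B \<in> carrier (presented_group R)"
    then obtain u v where "A = word_class R u" "B = word_class R v"
      by (auto simp: presented_carrier)
    then show "h A \<in> carrier G" "h (A \<otimes>\<^bsub>presented_group R\<^esub> B) = h A \<otimes> h B"
      using f by (simp_all add: h)
  qed
  then show thesis using h by (rule that)
qed

end

text \<open>Letters with \<open>False\<close> stand for inverses, which \<open>generate\<close>
  supplies itself, so the positive letters suffice.\<close>

lemma presented_group_generated:
  "carrier (presented_group R) = generate (presented_group R) (range (\<lambda>i. word_class R [(i, True)]))"
    (is "?C = generate ?P ?X")
proof -
  interpret group ?P by simp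
  have X: "?X \<subseteq> ?C" by auto
  have letter: "word_class R [(i, b)] \<in> generate ?P ?X" for i b
  proof (cases b)
    case True
    then show ?thesis by (auto intro: generate.incl)
  next
    case False
    have "word_class R [(i, False)] \<otimes>\<^bsub>?P\<^esub> word_class R [(i, True)] = \<one>\<^bsub>?P\<^esub>"
      using word_cong.cancel[of R i False] by (simp add: presented_one word_class_eq_iff)
    then have "word_class R [(i, False)] = inv\<^bsub>?P\<^esub> word_class R [(i, True)]"
      by (metis inv_equality word_class_closed)
    with False show ?thesis by (auto intro: generate.inv)
  qed
  have "word_class R u \<in> generate ?P ?X" for u
  proof (induction u)
    case Nil
    then show ?case by (metis generate.one presented_one)
  next
    case (Cons l u)
    have "word_class R (l # u) = word_class R [l] \<otimes>\<^bsub>?P\<^esub> word_class R u" by simp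
    with Cons letter show ?case by (metis generate.eng surj_pair)
  qed
  then have "?C \<subseteq> generate ?P ?X" unfolding presented_carrier by blast
  with generate_incl[OF X] show ?thesis by blast
qed

section \<open>Groups generated by involutions\<close>

context group
begin

text \<open>Since x normalises N, it can be moved past elements of N:
  \<open>h x k = h (x k x) x\<close>. The groups below are built by adjoining one involution at a
  time, from the rotations to the dihedral subgroup and then to G.\<close>

lemma subgroup_adjoin_involution:
  assumes N: "subgroup N G" and x: "x \<in> carrier G" "x \<otimes> x = \<one>"
    and conj: "\<And>h. h \<in> N \<Longrightarrow> x \<otimes> h \<otimes> x \<in> N"
  shows "subgroup (N \<union> (N #> x)) G"
proof -
  have NC: "h \<in> carrier G" if "h \<in> N" for h
    using that N by (simp add: subgroup.mem_carrier)
  have inv_x: "inv x = x" using x by (simp add: inv_equality)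
  have swap: "x \<otimes> h = x \<otimes> h \<otimes> x \<otimes> x" if "h \<in> N" for h
    using that x by (simp add: m_assoc NC)
  have coset: "h \<otimes> x \<in> N #> x" if "h \<in> N" for h
    using that by (auto simp: r_coset_def)
  have mixed: "h \<otimes> x \<otimes> k \<in> N #> x" if "h \<in> N" "k \<in> N" for h k
  proof -
    have "h \<otimes> x \<otimes> k = h \<otimes> (x \<otimes> k \<otimes> x) \<otimes> x"
      using that x by (simp add: m_assoc NC)
    then show ?thesis
      using coset[OF subgroup.m_closed[OF N that(1) conj[OF that(2)]]] by simp
  qed
  show ?thesis
  proof (rule subgroupI)
    show "N \<union> (N #> x) \<subseteq> carrier G"
      using NC x by (auto simp: r_coset_def)
    show "N \<union> (N #> x) \<noteq> {}"
      using subgroup.one_closed[OF N] by blast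
  next
    fix y assume "y \<in> N \<union> (N #> x)"
    then show "inv y \<in> N \<union> (N #> x)"
    proof
      assume "y \<in> N"
      then show ?thesis using subgroup.m_inv_closed[OF N] by blast
    next
      assume "y \<in> N #> x"
      then obtain h where h: "h \<in> N" "y = h \<otimes> x" by (auto simp: r_coset_def)
      have "inv y = \<one> \<otimes> x \<otimes> inv h"
        using h x NC by (simp add: inv_mult_group inv_x)
      then show ?thesis
        using mixed[OF subgroup.one_closed[OF N] subgroup.m_inv_closed[OF N h(1)]] by simp
    qed
  next
    fix y w assume yw: "y \<in> N \<union> (N #> x)" "w \<in> N \<union> (N #> x)"
    have half: "y \<otimes> k \<in> N \<union> (N #> x)" if "k \<in> N" for k
      using yw(1)
    proof
      assume "y \<in> N"
      then show ?thesis using subgroup.m_closed[OF N] that by blast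
    next
      assume "y \<in> N #> x"
      then obtain h where "h \<in> N" "y = h \<otimes> x" by (auto simp: r_coset_def)
      then show ?thesis using mixed[OF _ that] by blast
    qed
    have times_x: "u \<otimes> x \<in> N \<union> (N #> x)" if "u \<in> N \<union> (N #> x)" for u
      using that
    proof
      assume "u \<in> N"
      then show ?thesis using coset by blast
    next
      assume "u \<in> N #> x"
      then obtain h where "h \<in> N" "u = h \<otimes> x" by (auto simp: r_coset_def)
      then show ?thesis using x by (simp add: m_assoc NC)
    qed
    show "y \<otimes> w \<in> N \<union> (N #> x)"
      using yw(2)
    proof
      assume "w \<in> N"
      then show ?thesis by (rule half)
    next
      assume "w \<in> N #> x"
      then obtain k where k: "k \<in> N" "w = k \<otimes> x" by (auto simp: r_coset_def)
      have "y \<in> carrier G" using yw(1) NC x by (auto simp: r_coset_def)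
      then have "y \<otimes> w = y \<otimes> k \<otimes> x" using k x NC by (simp add: m_assoc)
      then show ?thesis using times_x[OF half[OF k(1)]] by simp
    qed
  qed
qed

text \<open>\<open>N\<close> and \<open>N #> x\<close> are cosets of equal size, and disjoint as
  soon as x lies outside N.\<close>

lemma
  assumes N: "subgroup N G" "finite N" and x: "x \<in> carrier G"
  shows finite_adjoin: "finite (N \<union> (N #> x))"
    and card_adjoin_le: "card (N \<union> (N #> x)) \<le> 2 * card N"
    and card_adjoin: "x \<notin> N \<Longrightarrow> card (N \<union> (N #> x)) = 2 * card N"
proof -
  have coset: "N #> x \<in> rcosets N" "N \<subseteq> carrier G"
    using rcosetsI[OF subgroup.subset[OF N(1)] x] subgroup.subset[OF N(1)] by auto
  have fin: "finite (N #> x)" and card: "card (N #> x) = card N"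
    using rcosets_finite[OF coset N(2)] card_rcosets_equal[OF coset] by auto
  show "finite (N \<union> (N #> x))" using N(2) fin by simp
  show "card (N \<union> (N #> x)) \<le> 2 * card N"
    using card_Un_le[of N "N #> x"] card by simp
  assume "x \<notin> N"
  have "N \<inter> (N #> x) = {}"
  proof (rule ccontr)
    assume "N \<inter> (N #> x) \<noteq> {}"
    then obtain h where h: "h \<in> N" "h \<otimes> x \<in> N" by (auto simp: r_coset_def)
    have "h \<in> carrier G" using h N(1) by (simp add: subgroup.mem_carrier)
    then have "x = inv h \<otimes> (h \<otimes> x)" using x by (simp flip: m_assoc)
    then have "x \<in> N" using h N(1) by (metis subgroup.m_closed subgroup.m_inv_closed)
    with \<open>x \<notin> N\<close> show False by simp
  qed
  then show "card (N \<union> (N #> x)) = 2 * card N"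
    using card_Un_disjoint[OF N(2) fin] card by simp
qed

lemma generate_involution:
  assumes "x \<in> carrier G" "x \<otimes> x = \<one>"
  shows "generate G {x} = {\<one>, x}"
proof -
  have "subgroup ({\<one>} \<union> ({\<one>} #> x)) G"
    by (rule subgroup_adjoin_involution[OF triv_subgroup]) (use assms in auto)
  then have "subgroup {\<one>, x} G"
    using assms(1) by (simp add: r_coset_def insert_commute)
  from generate_subgroup_incl[OF _ this, of "{x}"] show ?thesis
    by (auto intro: generate.intros)
qed

lemma ord_eq_2_iff:
  assumes "x \<in> carrier G"
  shows "ord x = 2 \<longleftrightarrow> x \<otimes> x = \<one> \<and> x \<noteq> \<one>"
proof -
  have sq: "x [^] (2::nat) = x \<otimes> x" using assms by (simp add: numeral_2_eq_2)
  show ?thesis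
  proof
    assume "ord x = 2"
    then show "x \<otimes> x = \<one> \<and> x \<noteq> \<one>"
      using pow_ord_eq_1[OF assms] sq by auto
  next
    assume x: "x \<otimes> x = \<one> \<and> x \<noteq> \<one>"
    then have "ord x dvd 2" using pow_eq_id[OF assms, of 2] sq by simp
    moreover have "ord x \<noteq> 1" using x ord_eq_1[OF assms] by simp
    ultimately show "ord x = 2"
      using two_is_prime_nat prime_nat_iff by metis
  qed
qed

end

section \<open>The dihedral subgroup generated by two involutions\<close>

locale involution_pair = group G for G (structure) +
  fixes a b
  assumes a_closed [simp]: "a \<in> carrier G" and b_closed [simp]: "b \<in> carrier G"
    and a_sq [simp]: "a \<otimes> a = \<one>" and b_sq [simp]: "b \<otimes> b = \<one>"
begin

definition "\<rho> = a \<otimes> b"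
definition "R = generate G {\<rho>}"
definition "D = generate G {a, b}"

lemma inv_a [simp]: "inv a = a" and inv_b [simp]: "inv b = b"
  by (simp_all add: inv_equality)

lemma a_cancel [simp]: "x \<in> carrier G \<Longrightarrow> a \<otimes> (a \<otimes> x) = x"
  and b_cancel [simp]: "x \<in> carrier G \<Longrightarrow> b \<otimes> (b \<otimes> x) = x"
  by (simp_all flip: m_assoc)

lemma rho_closed [simp]: "\<rho> \<in> carrier G"
  by (simp add: \<rho>_def)

lemma inv_rho: "inv \<rho> = b \<otimes> a"
  by (simp add: \<rho>_def inv_mult_group)

lemma subgroup_R: "subgroup R G" and subgroup_D: "subgroup D G"
  by (simp_all add: R_def D_def generate_is_subgroup)

lemma R_closed [simp]: "x \<in> R \<Longrightarrow> x \<in> carrier G"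
  and D_closed [simp]: "x \<in> D \<Longrightarrow> x \<in> carrier G"
  using subgroup_R subgroup_D by (simp_all add: subgroup.mem_carrier)

lemma R_commute: "x \<in> R \<Longrightarrow> y \<in> R \<Longrightarrow> x \<otimes> y = y \<otimes> x"
  unfolding R_def generate_pow[OF rho_closed]
  by (auto simp: int_pow_mult[symmetric] add.commute)

text \<open>The case of the generator is \<open>a (a b) a = b a\<close>. Conjugation respects
  products, while inversion reverses them; commutativity of \<open>R\<close> removes the
  difference.\<close>

lemma reflect: "x \<in> R \<Longrightarrow> a \<otimes> x \<otimes> a = inv x"
  unfolding R_def
proof (induction rule: generate.induct)
  case one
  show ?case by simp
next
  case (incl h)
  then show ?case by (simp add: inv_rho) (simp add: \<rho>_def m_assoc)
next
  case (inv h)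
  have "a \<otimes> (b \<otimes> a) \<otimes> a = \<rho>" by (simp add: \<rho>_def m_assoc)
  with inv show ?case by (simp flip: inv_rho)
next
  case (eng x y)
  then have xy: "x \<in> R" "y \<in> R" by (simp_all add: R_def)
  have "a \<otimes> (x \<otimes> y) \<otimes> a = (a \<otimes> x \<otimes> a) \<otimes> (a \<otimes> y \<otimes> a)"
    using xy by (simp add: m_assoc)
  also have "\<dots> = inv (y \<otimes> x)" using eng xy by (simp add: inv_mult_group)
  finally show ?case using R_commute[OF xy] by simp
qed

lemma D_eq: "D = R \<union> (R #> a)"
proof
  have "subgroup (R \<union> (R #> a)) G"
    by (rule subgroup_adjoin_involution[OF subgroup_R])
       (simp_all add: reflect subgroup.m_inv_closed[OF subgroup_R])
  \<comment> \<open>Both generators lie in the coset: \<open>b\<close> is the inverse of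
    \<open>\<rho>\<close> times \<open>a\<close>.\<close>
  moreover have "\<one> \<otimes> a \<in> R #> a" "inv \<rho> \<otimes> a \<in> R #> a"
    using subgroup.one_closed[OF subgroup_R] generate.inv[of \<rho> "{\<rho>}" G]
    by (auto simp: r_coset_def R_def)
  then have "a \<in> R #> a" "b \<in> R #> a"
    by (simp_all add: inv_rho m_assoc)
  ultimately show "D \<subseteq> R \<union> (R #> a)"
    unfolding D_def by (intro generate_subgroup_incl) auto
next
  have ab: "a \<in> D" "b \<in> D" by (auto simp: D_def intro: generate.incl)
  then have "\<rho> \<in> D" using subgroup.m_closed[OF subgroup_D] by (simp add: \<rho>_def)
  then have "R \<subseteq> D" unfolding R_def by (intro generate_subgroup_incl subgroup_D) simp
  then show "R \<union> (R #> a) \<subseteq> D"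
    using ab subgroup.m_closed[OF subgroup_D] by (auto simp: r_coset_def)
qed

lemma card_R: "card R = ord \<rho>"
  by (simp add: R_def generate_pow_card)

lemma finite_R: "ord \<rho> > 0 \<Longrightarrow> finite R"
  using card_R by (metis card_ge_0_finite)

lemma finite_D: "ord \<rho> > 0 \<Longrightarrow> finite D"
  unfolding D_eq using finite_adjoin[OF subgroup_R finite_R a_closed] .

lemma card_D_le: "ord \<rho> > 0 \<Longrightarrow> card D \<le> 2 * ord \<rho>"
  unfolding D_eq using card_adjoin_le[OF subgroup_R finite_R a_closed] by (simp add: card_R)

lemma rho_in_R: "\<rho> \<in> R"
  by (simp add: R_def generate.incl)

text \<open>Inside the abelian group \<open>R\<close> the element \<open>a\<close> would commute
  with \<open>\<rho>\<close>, yet it inverts \<open>\<rho>\<close>, so \<open>\<rho>\<close> would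
  be its own inverse.\<close>

lemma reflection_notin_R:
  assumes "\<rho> \<otimes> \<rho> \<noteq> \<one>"
  shows "a \<notin> R"
proof
  assume "a \<in> R"
  then have "a \<otimes> \<rho> \<otimes> a = \<rho> \<otimes> (a \<otimes> a)"
    using R_commute[OF _ rho_in_R] by (simp add: m_assoc)
  then have "inv \<rho> = \<rho>" using reflect[OF rho_in_R] by simp
  then have "\<rho> \<otimes> \<rho> = \<one>" by (metis r_inv rho_closed)
  with assms show False by simp
qed

lemma card_D: "ord \<rho> > 0 \<Longrightarrow> \<rho> \<otimes> \<rho> \<noteq> \<one> \<Longrightarrow> card D = 2 * ord \<rho>"
  unfolding D_eq using card_adjoin[OF subgroup_R finite_R a_closed] reflection_notin_R
  by (simp add: card_R)

text \<open>A reflection commuting with \<open>\<rho>\<close> would make \<open>\<rho>\<close> its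
  own inverse, so z is a rotation; and a cyclic group contains at most one involution, the half
  turn.\<close>

lemma central_involution_in_D:
  assumes "ord \<rho> > 0" "\<rho> \<otimes> \<rho> \<noteq> \<one>" "z \<in> D" "z \<otimes> z = \<one>" "z \<noteq> \<one>" "z \<otimes> \<rho> = \<rho> \<otimes> z"
  shows "even (ord \<rho>) \<and> z = \<rho> [^] (ord \<rho> div 2)"
proof -
  have "z \<notin> R #> a"
  proof
    assume "z \<in> R #> a"
    then obtain h where h: "h \<in> R" "z = h \<otimes> a" by (auto simp: r_coset_def)
    have hC: "h \<in> carrier G" using h by simp
    have "h \<otimes> (a \<otimes> \<rho>) = z \<otimes> \<rho>" using hC by (simp add: h m_assoc)
    also have "\<dots> = (\<rho> \<otimes> h) \<otimes> a" unfolding assms(6) using hC by (simp add: h m_assoc)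
    also have "\<dots> = h \<otimes> (\<rho> \<otimes> a)"
      unfolding R_commute[OF rho_in_R h(1)] using hC by (simp add: m_assoc)
    finally have "a \<otimes> \<rho> = \<rho> \<otimes> a" using hC by simp
    then have "a \<otimes> \<rho> \<otimes> a = \<rho> \<otimes> (a \<otimes> a)"
by (simp add: m_assoc)
    then have "inv \<rho> = \<rho>" using reflect[OF rho_in_R] by simp
    then have "\<rho> \<otimes> \<rho> = \<one>" by (metis r_inv rho_closed)
    with assms show False by simp
  qed
  with assms have "z \<in> R" by (simp add: D_eq)
  \<comment> \<open>The exponent is reduced modulo the order, which makes the size comparison below
    possible.\<close>
  then obtain k where k: "k < ord \<rho>" "z = \<rho> [^] k"
  proof -
    from \<open>z \<in> R\<close> obtain i :: nat where "z = \<rho> [^] i"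
      using generate_pow_nat[OF rho_closed] assms(1) by (auto simp: R_def)
    moreover have "\<rho> [^] i = \<rho> [^] (ord \<rho> * (i div ord \<rho>)) \<otimes> \<rho> [^] (i mod ord \<rho>)"
      by (simp add: nat_pow_mult)
    moreover have "\<rho> [^] (ord \<rho> * (i div ord \<rho>)) = \<one>"
      by (simp add: pow_eq_id)
    ultimately have "z = \<rho> [^] (i mod ord \<rho>)" by simp
    then show thesis using assms(1) by (intro that[of "i mod ord \<rho>"]) simp_all
  qed
  have "\<rho> [^] (k + k) = \<one>" using assms(4) k by (simp add: nat_pow_mult)
  then have dvd: "ord \<rho> dvd k + k" by (simp add: pow_eq_id)
  have "k \<noteq> 0" using assms(5) k(2) by (cases k) auto
  \<comment> \<open>Here \<open>k + k\<close> is a positive multiple of the order and less than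
    twice the order.\<close>
  have "k + k = ord \<rho>"
  proof -
    obtain c where c: "k + k = ord \<rho> * c" using dvd by (elim dvdE)
    moreover have "k + k < ord \<rho> * 2" using k(1) by simp
    ultimately have "c < 2" by (simp only: nat_mult_less_cancel1[OF assms(1)])
    moreover have "c \<noteq> 0" using c \<open>k \<noteq> 0\<close> by (cases c) auto
    ultimately have "c = 1" by simp
    with c show ?thesis by simp
  qed
  then have "ord \<rho> = 2 * k" by simp
  then show ?thesis using k(2) by simp
qed

end

lemma (in group) generate_commuting_involutions:
  assumes "x \<in> carrier G" "y \<in> carrier G" "x \<otimes> x = \<one>" "y \<otimes> y = \<one>" "y \<otimes> x = x \<otimes> y"
  shows "generate G {x, y} = {\<one>, x, y, x \<otimes> y}"
proof -
  have eq: "{\<one>, x} \<union> ({\<one>, x} #> y) = {\<one>, x, y, x \<otimes> y}"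
    using assms by (auto simp: r_coset_def)
  have "subgroup {\<one>, x} G"
    using generate_is_subgroup[of "{x}"] generate_involution[of x] assms by simp
  then have "subgroup ({\<one>, x} \<union> ({\<one>, x} #> y)) G"
    using assms(2,4)
  proof (rule subgroup_adjoin_involution)
    fix h assume "h \<in> {\<one>, x}"
    then show "y \<otimes> h \<otimes> y \<in> {\<one>, x}" using assms by (auto simp: m_assoc)
  qed
  then have "generate G {x, y} \<subseteq> {\<one>, x, y, x \<otimes> y}"
    unfolding eq by (intro generate_subgroup_incl) auto
  then show ?thesis by (auto intro: generate.intros)
qed

section \<open>Hypermaps with a central generator\<close>

text \<open>The involutions enter through equations alone, so a presented group is an instance
  before it is known that its generators do not collapse; nondegeneracy is added in
  \<open>central_hypermap\<close>.\<close>

locale central_triple = involution_pair G a b for G (structure) and a b +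
  fixes z
  assumes z_closed [simp]: "z \<in> carrier G" and z_sq [simp]: "z \<otimes> z = \<one>"
    and z_a: "z \<otimes> a = a \<otimes> z" and z_b: "z \<otimes> b = b \<otimes> z"
    and generated: "carrier G = generate G {a, b, z}"
begin

lemma inv_z [simp]: "inv z = z"
  by (simp add: inv_equality)

lemma z_central: "x \<in> carrier G \<Longrightarrow> z \<otimes> x = x \<otimes> z"
proof -
  assume "x \<in> carrier G"
  then have "x \<in> generate G {a, b, z}" by (simp flip: generated)
  then show "z \<otimes> x = x \<otimes> z"
  proof (induction rule: generate.induct)
    case (eng x y)
    then have "x \<in> carrier G" "y \<in> carrier G" by (simp_all add: generated)
    with eng show ?case by (metis m_assoc z_closed)
  next
    case (inv h)
    then show ?case by (auto simp: z_a z_b)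
  qed (auto simp: z_a z_b)
qed

lemma z_left_commute: "x \<in> carrier G \<Longrightarrow> y \<in> carrier G \<Longrightarrow> z \<otimes> (x \<otimes> y) = x \<otimes> (z \<otimes> y)"
  by (metis m_assoc z_central z_closed)

lemma carrier_eq: "carrier G = D \<union> (D #> z)"
proof
  have "subgroup (D \<union> (D #> z)) G"
    using subgroup_D z_closed z_sq
  proof (rule subgroup_adjoin_involution)
    fix h assume "h \<in> D"
    then show "z \<otimes> h \<otimes> z \<in> D" by (simp add: z_central m_assoc)
  qed
  moreover have "a \<in> D" "b \<in> D" "\<one> \<otimes> z \<in> D #> z"
    using subgroup.one_closed[OF subgroup_D] by (auto simp: D_def r_coset_def intro: generate.incl)
  ultimately show "carrier G \<subseteq> D \<union> (D #> z)"
    unfolding generated by (intro generate_subgroup_incl) auto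
  show "D \<union> (D #> z) \<subseteq> carrier G"
    by (auto simp: r_coset_def)
qed

lemma finite_if_ord_pos: "ord \<rho> > 0 \<Longrightarrow> finite (carrier G)"
  unfolding carrier_eq by (rule finite_adjoin[OF subgroup_D finite_D z_closed])

lemma carrier_eq_D: "z \<in> D \<Longrightarrow> carrier G = D"
  using carrier_eq subgroup.m_closed[OF subgroup_D] by (auto simp: r_coset_def)

text \<open>Each adjunction at most doubles the size. This bound is already available in a presented
  group, where only some power of \<open>\<rho>\<close> is known to vanish.\<close>

lemma order_le: "ord \<rho> > 0 \<Longrightarrow> order G \<le> 4 * ord \<rho>"
  using card_adjoin_le[OF subgroup_D finite_D z_closed] card_D_le
  unfolding order_def carrier_eq by simp

lemma order_le_if_in_D: "ord \<rho> > 0 \<Longrightarrow> z \<in> D \<Longrightarrow> order G \<le> 2 * ord \<rho>"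
  using card_D_le carrier_eq_D by (simp add: order_def)

lemma order_eq:
  assumes "ord \<rho> > 0" "\<rho> \<otimes> \<rho> \<noteq> \<one>"
  shows "order G = (if z \<in> D then 2 else 4) * ord \<rho>"
proof (cases "z \<in> D")
  case True
  then show ?thesis using card_D[OF assms] carrier_eq_D by (simp add: order_def)
next
  case False
  then show ?thesis
    using card_adjoin[OF subgroup_D finite_D z_closed] card_D assms
    by (simp add: order_def flip: carrier_eq)
qed

text \<open>Rotations are killed by the order of \<open>\<rho>\<close>; reflections and z square to
  one, so an even exponent kills them; and z commutes with everything. The resulting exponent bound
  later separates the two presentations.\<close>

lemma pow_even_ord_rho:
  assumes "even (ord \<rho>)" "x \<in> carrier G"
  shows "x [^] ord \<rho> = \<one>"
proof -
  have R: "y [^] ord \<rho> = \<one>" if y: "y \<in> R" for y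
  proof -
    obtain i :: int where "y = \<rho> [^] i"
      using y by (auto simp: R_def generate_pow[OF rho_closed])
    then have "y [^] ord \<rho> = (\<rho> [^] ord \<rho>) [^] i"
      by (metis int_pow_int int_pow_pow mult.commute rho_closed)
    then show ?thesis by simp
  qed
  have even_pow: "y [^] ord \<rho> = \<one>" if "y \<otimes> y = \<one>" "y \<in> carrier G" for y
  proof -
    obtain k where "ord \<rho> = 2 * k" using assms(1) by blast
    moreover have "y [^] (2::nat) = \<one>" using that by (simp add: numeral_2_eq_2)
    ultimately show ?thesis using that by (metis nat_pow_one nat_pow_pow)
  qed
  have D: "y [^] ord \<rho> = \<one>" if "y \<in> D" for y
    using that unfolding D_eq
  proof
    assume "y \<in> R #> a"
    then obtain h where h: "h \<in> R" "y = h \<otimes> a" by (auto simp: r_coset_def)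
    have "y \<otimes> y = h \<otimes> (a \<otimes> h \<otimes> a)" using h by (simp add: m_assoc)
    also have "\<dots> = \<one>" using h reflect by simp
    finally show ?thesis using even_pow h by simp
  qed (rule R)
  show ?thesis
    using assms(2) unfolding carrier_eq
  proof
    assume "x \<in> D #> z"
    then obtain h where h: "h \<in> D" "x = h \<otimes> z" by (auto simp: r_coset_def)
    then show ?thesis
      using D[OF h(1)] even_pow[of z] by (simp add: pow_mult_distrib z_central)
  qed (rule D)
qed

end

section \<open>Nondegenerate triples: linearity, type, cell counts and surface\<close>

locale central_hypermap = central_triple +
  assumes ord_pos: "ord \<rho> > 0" and rho_sq: "\<rho> \<otimes> \<rho> \<noteq> \<one>" "\<rho> \<otimes> \<rho> \<noteq> z" and z_ne: "z \<noteq> \<one>"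
begin

lemma rho_sq_eq: "\<rho> \<otimes> \<rho> = a \<otimes> (b \<otimes> (a \<otimes> b))"
  by (simp add: \<rho>_def m_assoc)

text \<open>Each of these coincidences would make \<open>a\<close> and \<open>b\<close> commute, and
  then \<open>\<rho> \<otimes> \<rho>\<close> would be trivial.\<close>

lemma distinct_elems: "a \<noteq> \<one>" "b \<noteq> \<one>" "a \<noteq> b" "a \<noteq> z" "b \<noteq> z" "a \<otimes> z \<noteq> b" "b \<otimes> z \<noteq> a"
  "a \<otimes> z \<noteq> \<one>" "b \<otimes> z \<noteq> \<one>"
proof -
  show "a \<noteq> \<one>" "b \<noteq> \<one>" "a \<noteq> b" using rho_sq(1) by (auto simp: \<rho>_def)
  show "a \<noteq> z" using rho_sq(1) z_b by (auto simp: rho_sq_eq)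
  show "b \<noteq> z" using rho_sq(1) z_left_commute[of a z] by (auto simp: rho_sq_eq)
  then show "b \<otimes> z \<noteq> \<one>" using inv_equality[of b z] by auto
  show "a \<otimes> z \<noteq> \<one>" using \<open>a \<noteq> z\<close> inv_equality[of a z] by auto
  show "a \<otimes> z \<noteq> b" "b \<otimes> z \<noteq> a" using rho_sq(1) by (auto simp: rho_sq_eq m_assoc z_a z_b z_left_commute)
qed

lemma H_eq: "generate G {b, z} = {\<one>, b, z, b \<otimes> z}"
  and K_eq: "generate G {a, z} = {\<one>, a, z, a \<otimes> z}"
  by (simp_all add: generate_commuting_involutions z_a z_b)

lemma card_H: "card (generate G {b, z}) = 4" and card_K: "card (generate G {a, z}) = 4"
proof -
  have "a \<otimes> z \<notin> {\<one>, a, z}" "b \<otimes> z \<notin> {\<one>, b, z}"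
    using distinct_elems z_ne by auto
  with distinct_elems z_ne show "card (generate G {b, z}) = 4" "card (generate G {a, z}) = 4"
    unfolding H_eq K_eq by auto
qed

text \<open>\<open>H\<close> and \<open>K\<close> are four-groups, so HK adds only
  \<open>b a\<close> and \<open>b a z\<close> to their union, and KH only \<open>a b\<close> and
  \<open>a b z\<close>. Linearity says that these two pairs are disjoint, that is, that
  \<open>a\<close> and \<open>b\<close> do not commute modulo z.\<close>

lemma regular_linear: "regular_linear_hypermap G a b z"
proof (intro_locales, unfold_locales)
  show "finite (carrier G)" using ord_pos by (rule finite_if_ord_pos)
  show "ord a = 2" "ord b = 2" "ord z = 2"
    using distinct_elems z_ne by (simp_all add: ord_eq_2_iff)
  show "a \<noteq> b" "a \<noteq> z" "b \<noteq> z" by (fact distinct_elems)+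
  show "carrier G = generate G {a, b, z}" by (fact generated)
  show "generate G {b, z} \<inter> generate G {a, z} = generate G {z}"
    unfolding H_eq K_eq generate_involution[OF z_closed z_sq] using distinct_elems by auto
  \<comment> \<open>Here w runs through \<open>\<langle>z\<rangle>\<close>; equality would give
    \<open>\<rho> \<otimes> \<rho> = w\<close>.\<close>
  have ne: "a \<otimes> b \<noteq> b \<otimes> (a \<otimes> w)" if "w \<in> {\<one>, z}" for w
  proof
    assume "a \<otimes> b = b \<otimes> (a \<otimes> w)"
    then have "\<rho> \<otimes> \<rho> = w" using that by (auto simp: rho_sq_eq)
    with that rho_sq show False by auto
  qed
  have ne': "a \<otimes> (b \<otimes> z) \<noteq> b \<otimes> (a \<otimes> w)" if "w \<in> {\<one>, z}" for w
  proof
    assume "a \<otimes> (b \<otimes> z) = b \<otimes> (a \<otimes> w)"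
    then have "a \<otimes> (b \<otimes> z) \<otimes> z = b \<otimes> (a \<otimes> w) \<otimes> z" by simp
    then have "a \<otimes> b = b \<otimes> (a \<otimes> (w \<otimes> z))" using that by (auto simp: m_assoc)
    moreover have "w \<otimes> z \<in> {\<one>, z}" using that by auto
    ultimately show False using ne by blast
  qed
  have "a \<otimes> b \<noteq> b \<otimes> a" "a \<otimes> (b \<otimes> z) \<noteq> b \<otimes> a" "a \<otimes> b \<noteq> b \<otimes> (a \<otimes> z)"
    "a \<otimes> (b \<otimes> z) \<noteq> b \<otimes> (a \<otimes> z)"
    using ne[of \<one>] ne[of z] ne'[of \<one>] ne'[of z] by simp_all
  moreover have "generate G {b, z} <#> generate G {a, z} =
      generate G {b, z} \<union> generate G {a, z} \<union> {b \<otimes> a, b \<otimes> (a \<otimes> z)}"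
    unfolding H_eq K_eq by (simp add: set_mult_def m_assoc z_a z_b z_left_commute) blast
  moreover have "generate G {a, z} <#> generate G {b, z} =
      generate G {b, z} \<union> generate G {a, z} \<union> {a \<otimes> b, a \<otimes> (b \<otimes> z)}"
    unfolding H_eq K_eq by (simp add: set_mult_def m_assoc z_a z_b z_left_commute) blast
  ultimately show "(generate G {b, z} <#> generate G {a, z}) \<inter> (generate G {a, z} <#> generate G {b, z}) =
      generate G {b, z} \<union> generate G {a, z}"
    by auto
qed auto

lemma hypermap_type: "hypermap_type G a b z = (2, 2, ord \<rho>)"
proof -
  have "ord (b \<otimes> z) = 2" "ord (a \<otimes> z) = 2"
    using distinct_elems by (simp_all add: ord_eq_2_iff m_assoc z_a z_b z_left_commute)
  then show ?thesis by (simp add: hypermap_type_def \<rho>_def)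
qed

text \<open>Lagrange's theorem, with two four-groups and the dihedral group \<open>D\<close> as
  stabilisers. The product form avoids truncating division.\<close>

lemma card_cells:
  "4 * card (vertices G a b z) = order G"
  "4 * card (hyperedges G a b z) = order G"
  "2 * ord \<rho> * card (hyperfaces G a b z) = order G"
proof -
  have lagr: "card (generate G S) * card (lcosets (generate G S)) = order G" if "S \<subseteq> carrier G" for S
    using l_lagrange[OF finite_if_ord_pos generate_is_subgroup] ord_pos that by (simp add: mult.commute)
  show "4 * card (vertices G a b z) = order G"
    using lagr[of "{b, z}"] by (simp add: vertices_def card_H)
  show "4 * card (hyperedges G a b z) = order G"
    using lagr[of "{a, z}"] by (simp add: hyperedges_def card_K)
  show "2 * ord \<rho> * card (hyperfaces G a b z) = order G"
    using lagr[of "{a, b}"] card_D ord_pos rho_sq by (simp add: hyperfaces_def D_def)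
qed

text \<open>The pair \<open>az, bz\<close> has the same product as \<open>a, b\<close>, so it generates a subgroup of the same order.\<close>

lemma non_orientable_iff: "non_orientable G a b z \<longleftrightarrow> order G = 2 * ord \<rho>"
proof -
  interpret twisted: involution_pair G "a \<otimes> z" "b \<otimes> z"
    by unfold_locales (simp_all add: m_assoc z_a z_b z_left_commute)
  have rho: "twisted.\<rho> = \<rho>"
    by (simp add: twisted.\<rho>_def \<rho>_def m_assoc z_a z_b z_left_commute)
  have card: "card twisted.D = 2 * ord \<rho>"
    using twisted.card_D ord_pos rho_sq(1) unfolding rho by simp
  have fin: "finite (carrier G)" and sub: "twisted.D \<subseteq> carrier G"
    using finite_if_ord_pos ord_pos by auto
  have "carrier G = twisted.D \<longleftrightarrow> order G = 2 * ord \<rho>"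
    using card_subset_eq[OF fin sub] card by (auto simp: order_def)
  then show ?thesis
    by (simp add: non_orientable_def twisted.D_def)
qed

lemma M_sequence_if_order_4:
  assumes "order G = 4 * ord \<rho>"
  shows "M_sequence G a b z = (0, (2, 2, ord \<rho>), (ord \<rho>, ord \<rho>, 2), 4 * ord \<rho>)"
    and "orientable G a b z"
proof -
  show ori: "orientable G a b z"
    using non_orientable_iff assms ord_pos by simp
  have cards: "card (vertices G a b z) = ord \<rho>" "card (hyperedges G a b z) = ord \<rho>"
    "card (hyperfaces G a b z) = 2"
    using card_cells assms ord_pos by simp_all
  \<comment> \<open>With k the order of \<open>\<rho>\<close>, the Euler characteristic is k + k + 2
    - 2k = 2.\<close>
  have "genus G a b z = 0"
    using ori unfolding genus_def euler_characteristic_def cards assms by (intro the_equality) auto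
  then show "M_sequence G a b z = (0, (2, 2, ord \<rho>), (ord \<rho>, ord \<rho>, 2), 4 * ord \<rho>)"
    by (simp add: M_sequence_def hypermap_type cards assms)
qed

lemma M_sequence_if_order_2:
  assumes "order G = 2 * ord \<rho>"
  shows "M_sequence G a b z =
      (1, (2, 2, ord \<rho>), (ord \<rho> div 2, ord \<rho> div 2, 1), 2 * ord \<rho>)"
    and "non_orientable G a b z" and "on_projective_plane G a b z"
proof -
  show ori: "non_orientable G a b z"
    using non_orientable_iff assms by simp
  have cards: "2 * card (vertices G a b z) = ord \<rho>" "2 * card (hyperedges G a b z) = ord \<rho>"
    "card (hyperfaces G a b z) = 1"
    using card_cells assms ord_pos by simp_all
  \<comment> \<open>With k the order of \<open>\<rho>\<close>, the value is k/2 + k/2 + 1 - k. The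
    counts above are kept doubled so that halving is exact in the reals.\<close>
  have "euler_characteristic G a b z = 1"
    using cards(3) arg_cong[OF cards(1), of real] arg_cong[OF cards(2), of real]
    unfolding euler_characteristic_def assms by simp
  then have genus: "genus G a b z = 1"
    using ori unfolding genus_def by (intro the_equality) auto
  then show "on_projective_plane G a b z"
    using ori by (simp add: on_projective_plane_def)
  show "M_sequence G a b z =
      (1, (2, 2, ord \<rho>), (ord \<rho> div 2, ord \<rho> div 2, 1), 2 * ord \<rho>)"
    using genus cards by (auto simp: M_sequence_def hypermap_type assms)
qed

end

section \<open>The core of the vertex stabiliser\<close>

context regular_linear_hypermap
begin

lemma involution_sq: "r0 \<otimes> r0 = \<one>" "r1 \<otimes> r1 = \<one>" "r2 \<otimes> r2 = \<one>"
  and involution_ne_one: "r0 \<noteq> \<one>" "r1 \<noteq> \<one>" "r2 \<noteq> \<one>"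
  using involutions in_carrier by (simp_all add: ord_eq_2_iff)

lemma generate_r2: "generate G {r2} = {\<one>, r2}"
  by (simp add: generate_involution in_carrier involution_sq)

lemma subgroup_HK: "subgroup (generate G {r1, r2}) G" "subgroup (generate G {r0, r2}) G"
  using in_carrier by (simp_all add: generate_is_subgroup)

lemma r0_notin_H: "r0 \<notin> generate G {r1, r2}" and r1_notin_K: "r1 \<notin> generate G {r0, r2}"
proof -
  have "r0 \<in> generate G {r0, r2}" "r1 \<in> generate G {r1, r2}"
    by (auto intro: generate.incl)
  then show "r0 \<notin> generate G {r1, r2}" "r1 \<notin> generate G {r0, r2}"
    using inter distinct involution_ne_one unfolding generate_r2 by blast+
qed

lemma normal_subset_r2:
  assumes N: "N \<lhd> G" "N \<subseteq> generate G {r1, r2}"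
  shows "N \<subseteq> {\<one>, r2}"
proof
  fix x assume x: "x \<in> N"
  let ?H = "generate G {r1, r2}" and ?K = "generate G {r0, r2}"
  have xC: "x \<in> carrier G" "inv r0 = r0" "x \<in> ?H"
    using x N in_carrier involution_sq(1) subgroup.mem_carrier[OF normal_imp_subgroup[OF N(1)] x]
    by (auto simp: inv_equality)
  have r0: "r0 \<in> ?K" by (auto intro: generate.incl)
  have "r0 \<otimes> x \<otimes> r0 \<in> N"
    using normal.inv_op_closed2[OF N(1) in_carrier(1) x] xC by simp
  moreover have "x \<otimes> r0 = r0 \<otimes> (r0 \<otimes> x \<otimes> r0)"
    using xC in_carrier involution_sq(1) by (simp flip: m_assoc)
  ultimately have "x \<otimes> r0 \<in> (?H <#> ?K) \<inter> (?K <#> ?H)"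
    using xC r0 N(2) unfolding set_mult_def by blast
  then have "x \<otimes> r0 \<in> ?H \<union> ?K" using linear by simp
  \<comment> \<open>If \<open>x r0\<close> were in H, then \<open>r0\<close> would be too. So
    \<open>x r0\<close> lies in K, and cancelling \<open>r0\<close> puts x into K.\<close>
  moreover have "x \<otimes> r0 \<notin> ?H"
  proof
    assume "x \<otimes> r0 \<in> ?H"
    then have "inv x \<otimes> (x \<otimes> r0) \<in> ?H"
      using xC subgroup_HK(1) by (simp add: subgroup.m_closed subgroup.m_inv_closed)
    then show False
      using r0_notin_H xC in_carrier by (simp flip: m_assoc)
  qed
  ultimately have "x \<otimes> r0 \<otimes> r0 \<in> ?K"
    using r0 subgroup.m_closed[OF subgroup_HK(2)] by blast
  then have "x \<in> ?K" using xC in_carrier involution_sq(1) by (simp add: m_assoc)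
  then show "x \<in> {\<one>, r2}" using xC(3) inter generate_r2 by blast
qed

text \<open>By \<open>normal_subset_r2\<close> the only candidates are the trivial group and
  \<open>\<langle>r2\<rangle>\<close>, so the greatest one exists and normality of
  \<open>\<langle>r2\<rangle>\<close> decides which it is.\<close>

lemma Core_eq:
  "Core G (generate G {r1, r2}) = (if generate G {r2} \<lhd> G then generate G {r2} else {\<one>})"
proof (cases "generate G {r2} \<lhd> G")
  case True
  have "generate G {r2} \<subseteq> generate G {r1, r2}" by (rule mono_generate) simp
  with True have "Core G (generate G {r1, r2}) = generate G {r2}"
    unfolding Core_def generate_r2 using normal_subset_r2 by (intro Greatest_equality) auto
  with True show ?thesis by simp
next
  case False
  have "Core G (generate G {r1, r2}) = {\<one>}"
    unfolding Core_def
  proof (rule Greatest_equality)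
    show "{\<one>} \<lhd> G \<and> {\<one>} \<subseteq> generate G {r1, r2}"
      using one_is_normal by (auto intro: generate.one)
  next
    fix N assume N: "N \<lhd> G \<and> N \<subseteq> generate G {r1, r2}"
    then have "N \<subseteq> {\<one>, r2}" "\<one> \<in> N"
      using normal_subset_r2 by (auto simp: normal_imp_subgroup subgroup.one_closed)
    moreover have "N \<noteq> {\<one>, r2}" using N False unfolding generate_r2 by auto
    ultimately show "N \<le> {\<one>}" by auto
  qed
  with False show ?thesis by simp
qed

text \<open>A normal subgroup of order two is central, which yields the commutation laws; the
  conditions on \<open>\<rho> \<otimes> \<rho>\<close> come from linearity.\<close>

lemma central_hypermap_if_Core:
  assumes "Core G (generate G {r1, r2}) = generate G {r2}"
  shows "central_hypermap G r0 r1 r2"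
proof -
  \<comment> \<open>Otherwise the core would be trivial, although \<open>r2\<close> is not.\<close>
  have normal: "{\<one>, r2} \<lhd> G"
    using assms Core_eq involution_ne_one(3) unfolding generate_r2 by (auto split: if_splits)
  have central: "r2 \<otimes> x = x \<otimes> r2" if x: "x \<in> carrier G" for x
  proof -
    have "x \<otimes> r2 \<otimes> inv x \<in> {\<one>, r2}"
      using normal.inv_op_closed2[OF normal x] by simp
    moreover have "x \<otimes> r2 \<otimes> inv x \<noteq> \<one>"
    proof
      assume "x \<otimes> r2 \<otimes> inv x = \<one>"
      then have "x \<otimes> r2 \<otimes> inv x \<otimes> x = x" using x by simp
      then have "x \<otimes> r2 = x" using x in_carrier by (simp add: m_assoc)
      then show False using x in_carrier involution_ne_one(3) by simp
    qed
    ultimately have "x \<otimes> r2 \<otimes> inv x \<otimes> x = r2 \<otimes> x" by simp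
    then show ?thesis using x in_carrier by (simp add: m_assoc)
  qed
  interpret central_triple G r0 r1 r2
    by unfold_locales (simp_all add: in_carrier involution_sq central flip: generated)
  \<comment> \<open>If the square lay in \<open>\<langle>r2\<rangle>\<close>, then
    \<open>r0 r1 = r1 (r0 \<rho> \<rho>)\<close> would lie in both HK and KH, hence in H or in K,
    which pulls \<open>r0\<close> into H or \<open>r1\<close> into K.\<close>
  have sq: "\<rho> \<otimes> \<rho> \<notin> {\<one>, r2}"
  proof
    assume sq: "\<rho> \<otimes> \<rho> \<in> {\<one>, r2}"
    let ?H = "generate G {r1, r2}" and ?K = "generate G {r0, r2}"
    have mem: "r0 \<in> ?K" "r1 \<in> ?H" by (auto intro: generate.incl)
    have "\<rho> \<otimes> \<rho> \<in> ?K" using sq by (auto intro: generate.intros)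
    then have "r0 \<otimes> (\<rho> \<otimes> \<rho>) \<in> ?K" using mem by (auto intro: generate.eng)
    moreover have "r0 \<otimes> r1 = r1 \<otimes> (r0 \<otimes> (\<rho> \<otimes> \<rho>))"
      by (simp add: \<rho>_def m_assoc)
    ultimately have "r0 \<otimes> r1 \<in> (?H <#> ?K) \<inter> (?K <#> ?H)"
      using mem unfolding set_mult_def by blast
    then have "r0 \<otimes> r1 \<in> ?H \<union> ?K" using linear by simp
    moreover have "r0 \<otimes> r1 \<notin> ?H"
    proof
      assume "r0 \<otimes> r1 \<in> ?H"
      then have "r0 \<otimes> r1 \<otimes> r1 \<in> ?H" using mem by (blast intro: generate.eng)
      then show False using r0_notin_H by (simp add: m_assoc)
    qed
    moreover have "r0 \<otimes> r1 \<notin> ?K"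
    proof
      assume "r0 \<otimes> r1 \<in> ?K"
      then have "r0 \<otimes> (r0 \<otimes> r1) \<in> ?K" using mem by (blast intro: generate.eng)
      then show False using r1_notin_K by simp
    qed
    ultimately show False by simp
  qed
  have "ord \<rho> > 0" using ord_ge_1[OF finite_carrier rho_closed] by simp
  with sq involution_ne_one(3) show ?thesis by unfold_locales auto
qed

text \<open>Automorphisms are left multiplications, since flags are acted on from the right.\<close>

lemma iso_hypermap_Aut: "G \<cong> hypermap_Aut G r0 r1 r2"
proof -
  define L where "L g = (\<lambda>x\<in>carrier G. g \<otimes> x)" for g
  have L: "L g \<in> extensional (carrier G) \<inter> hypermap_isos G r0 r1 r2 G r0 r1 r2"
    if g: "g \<in> carrier G" for g
  proof -
    have "bij_betw (L g) (carrier G) (carrier G)"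
      by (rule bij_betw_byWitness[where f' = "\<lambda>x. inv g \<otimes> x"])
         (use g in \<open>auto simp: L_def simp flip: m_assoc\<close>)
    then show ?thesis
      using g in_carrier by (auto simp: hypermap_isos_def L_def m_assoc)
  qed
  have Bij: "L g \<in> Bij (carrier G)" if "g \<in> carrier G" for g
    using L[OF that] by (auto simp: Bij_def hypermap_isos_def)
  have "L \<in> hom G (hypermap_Aut G r0 r1 r2)"
  proof (rule homI)
    fix g h assume gh: "g \<in> carrier G" "h \<in> carrier G"
    show "L g \<in> carrier (hypermap_Aut G r0 r1 r2)"
      using L gh by (simp add: hypermap_Aut_def)
    show "L (g \<otimes> h) = L g \<otimes>\<^bsub>hypermap_Aut G r0 r1 r2\<^esub> L h"
      using gh Bij by (auto simp: hypermap_Aut_def BijGroup_def compose_def L_def m_assoc)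
  qed
  moreover have "inj_on L (carrier G)"
  proof (rule inj_onI)
    fix g h assume gh: "g \<in> carrier G" "h \<in> carrier G" "L g = L h"
    then have "L g \<one> = L h \<one>" by simp
    then show "g = h" using gh by (simp add: L_def)
  qed
  moreover have "L ` carrier G = carrier (hypermap_Aut G r0 r1 r2)"
  proof
    show "L ` carrier G \<subseteq> carrier (hypermap_Aut G r0 r1 r2)"
      using L by (auto simp: hypermap_Aut_def)
  next
    show "carrier (hypermap_Aut G r0 r1 r2) \<subseteq> L ` carrier G"
    proof
      fix \<sigma> assume "\<sigma> \<in> carrier (hypermap_Aut G r0 r1 r2)"
      then have ext: "\<sigma> \<in> extensional (carrier G)"
        and bij: "bij_betw \<sigma> (carrier G) (carrier G)"
        and step: "\<And>x r. x \<in> carrier G \<Longrightarrow> r \<in> {r0, r1, r2} \<Longrightarrow> \<sigma> (x \<otimes> r) = \<sigma> x \<otimes> r"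
        by (auto simp: hypermap_Aut_def hypermap_isos_def)
      have gens: "{r0, r1, r2} \<subseteq> carrier G" using in_carrier by simp
      have closed: "\<sigma> x \<in> carrier G" if "x \<in> carrier G" for x
        using that bij by (auto simp: bij_betw_def)
      \<comment> \<open>A flag map commuting with the three generators commutes with right
        multiplication by every product of them, so it is determined by its value at
        \<open>\<one>\<close>. The flag y stays arbitrary because a product is handled in two
        moves.\<close>
      have "\<sigma> (y \<otimes> x) = \<sigma> y \<otimes> x" if "x \<in> generate G {r0, r1, r2}" "y \<in> carrier G" for x y
        using that
      proof (induction arbitrary: y rule: generate.induct)
        case one
        then show ?case by (simp add: closed)
      next
        case (incl h)
        then show ?case by (simp add: step)
      next
        case (inv h)
        then have h: "inv h = h"
          using in_carrier involution_sq by (auto simp: inv_equality)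
        show ?case using inv by (simp add: h step)
      next
        case (eng h k)
        then have hk: "h \<in> carrier G" "k \<in> carrier G"
          using generate_in_carrier[OF gens] by auto
        then have "\<sigma> (y \<otimes> (h \<otimes> k)) = \<sigma> (y \<otimes> h \<otimes> k)"
          using eng by (simp add: m_assoc)
        also have "\<dots> = \<sigma> (y \<otimes> h) \<otimes> k" using eng hk by simp
        also have "\<dots> = \<sigma> y \<otimes> (h \<otimes> k)" using eng hk by (simp add: m_assoc closed)
        finally show ?case .
      qed
      from this[of _ \<one>] have mult: "\<sigma> x = \<sigma> \<one> \<otimes> x" if "x \<in> carrier G" for x
        using that generated by auto
      have "\<sigma> = L (\<sigma> \<one>)"
      proof (rule extensionalityI[OF ext])
        show "L (\<sigma> \<one>) \<in> extensional (carrier G)" by (simp add: L_def)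
        fix x assume x: "x \<in> carrier G"
        show "\<sigma> x = L (\<sigma> \<one>) x" unfolding mult[OF x] using x by (simp add: L_def)
      qed
      then show "\<sigma> \<in> L ` carrier G" using closed by blast
    qed
  qed
  ultimately have "L \<in> iso G (hypermap_Aut G r0 r1 r2)" by (simp only: Group.iso_iff)
  then show ?thesis by (auto simp: is_iso_def)
qed

end

section \<open>Isomorphisms respecting generators\<close>

text \<open>Keeping track of the generators makes the map a hypermap isomorphism as well, while
  inverses and composites come from group isomorphisms. The hypermap isomorphisms of the
  classification are obtained this way.\<close>

definition marked_iso :: "('a, 'b) monoid_scheme \<Rightarrow> 'a \<Rightarrow> 'a \<Rightarrow> 'a \<Rightarrow>
    ('c, 'd) monoid_scheme \<Rightarrow> 'c \<Rightarrow> 'c \<Rightarrow> 'c \<Rightarrow> bool" where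
  "marked_iso G a b z G' a' b' z' \<longleftrightarrow> (\<exists>h\<in>iso G G'. h a = a' \<and> h b = b' \<and> h z = z')"

lemma marked_iso_imp_iso: "marked_iso G a b z G' a' b' z' \<Longrightarrow> G \<cong> G'"
  by (auto simp: marked_iso_def is_iso_def)

lemma marked_iso_sym:
  assumes "group G" "a \<in> carrier G" "b \<in> carrier G" "z \<in> carrier G"
    and "marked_iso G a b z G' a' b' z'"
  shows "marked_iso G' a' b' z' G a b z"
proof -
  obtain h where h: "h \<in> iso G G'" "h a = a'" "h b = b'" "h z = z'"
    using assms(5) by (auto simp: marked_iso_def)
  then have "inv_into (carrier G) h (h x) = x" if "x \<in> carrier G" for x
    using that by (auto simp: iso_iff)
  then show ?thesis
    using group.iso_set_sym[OF assms(1) h(1)] h assms(2-4) by (auto simp: marked_iso_def)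
qed

lemma marked_iso_trans:
  assumes "marked_iso G a b z G' a' b' z'" "marked_iso G' a' b' z' G'' a'' b'' z''"
  shows "marked_iso G a b z G'' a'' b'' z''"
  using assms iso_set_trans unfolding marked_iso_def by (metis comp_apply)

lemma marked_iso_imp_isomorphic_hypermaps:
  assumes "marked_iso G a b z G' a' b' z'" "a \<in> carrier G" "b \<in> carrier G" "z \<in> carrier G"
  shows "isomorphic_hypermaps G a b z G' a' b' z'"
proof -
  obtain h where "h \<in> iso G G'" "h a = a'" "h b = b'" "h z = z'"
    using assms(1) by (auto simp: marked_iso_def)
  then have "h \<in> hypermap_isos G a b z G' a' b' z'"
    using assms(2-4) by (auto simp: hypermap_isos_def iso_def hom_mult)
  then show ?thesis by (auto simp: isomorphic_hypermaps_def)
qed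

lemma iso_order_eq: "G \<cong> H \<Longrightarrow> order G = order H"
  by (auto simp: is_iso_def iso_def order_def bij_betw_same_card)

text \<open>The map is onto because it hits generators, and a surjection from a finite set onto one
  at least as large is injective. An upper bound on the order of a presented group is thus enough to
  identify it.\<close>

lemma hom_is_iso_if_order_le:
  assumes "group G" "group H" "h \<in> hom G H" "S \<subseteq> carrier G" "carrier H = generate H (h ` S)"
    and "finite (carrier G)" "order G \<le> order H"
  shows "h \<in> iso G H"
proof -
  interpret group_hom G H h
    using assms by (simp add: group_hom_def group_hom_axioms_def)
  have "carrier H \<subseteq> h ` carrier G"
    using assms(5) generate_img[OF assms(4)] G.generate_incl[OF assms(4)] by auto
  then have img: "h ` carrier G = carrier H" using hom_closed by blast
  then have "card (h ` carrier G) = card (carrier G)"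
    using assms(6,7) card_image_le[OF assms(6), of h] by (simp add: order_def)
  then have "inj_on h (carrier G)"
    by (rule eq_card_imp_inj_on[OF assms(6)])
  with img assms(3) show ?thesis by (simp only: Group.iso_iff)
qed

section \<open>The groups \<open>G\<^sub>1\<close> and \<open>G\<^sub>2\<close>\<close>

lemma (in group) involutions_commute:
  assumes "x \<in> carrier G" "y \<in> carrier G" "x \<otimes> x = \<one>" "y \<otimes> y = \<one>" "(x \<otimes> y) \<otimes> (x \<otimes> y) = \<one>"
  shows "x \<otimes> y = y \<otimes> x"
proof -
  have "inv x = x" "inv y = y" "inv (x \<otimes> y) = x \<otimes> y"
    using assms by (simp_all add: inv_equality)
  then show ?thesis using assms by (metis inv_mult_group)
qed

lemma presented_relation:
  "(u, v) \<in> R \<Longrightarrow> word_class R u = word_class R v"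
  by (simp add: word_class_eq_iff word_cong.relation)

lemma word_power_2: "word_power u 2 = u @ u"
  by (simp add: word_power_def numeral_2_eq_2)

lemma range_index: "range f = {f I0, f I1, f I2}"
proof -
  have UNIV: "UNIV = {I0, I1, I2}" using index.exhaust by auto
  show ?thesis unfolding UNIV by (simp only: image_insert image_empty)
qed

lemma presented_group_index_generated:
  "carrier (presented_group R) =
    generate (presented_group R) {word_class R x0, word_class R x1, word_class R x2}"
  by (subst presented_group_generated) (simp add: range_index)

text \<open>That the product of two involutions squares to one means that they commute, so the last
  two relations of \<open>R1\<close> make the class of \<open>x2\<close> central.\<close>

lemma central_triple_G1:
  "central_triple (G1 n) (word_class (R1 n) x0) (word_class (R1 n) x1) (word_class (R1 n) x2)"
proof -
  interpret group "G1 n" by simp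
  have one: "word_class (R1 n) (u @ u) = \<one>\<^bsub>G1 n\<^esub>" if "u \<in> {x0, x1, x2, x2 @ x1, x2 @ x0}" for u
    using that presented_relation[of "word_power u 2" "[]" "R1 n"]
    by (auto simp: R1_def word_power_2 presented_one)
  have comm: "word_class (R1 n) x2 \<otimes>\<^bsub>G1 n\<^esub> word_class (R1 n) u =
      word_class (R1 n) u \<otimes>\<^bsub>G1 n\<^esub> word_class (R1 n) x2" if "u \<in> {x0, x1}" for u
  proof (rule involutions_commute)
    show "word_class (R1 n) u \<otimes>\<^bsub>G1 n\<^esub> word_class (R1 n) u = \<one>\<^bsub>G1 n\<^esub>"
      using one[of u] that by auto
    show "word_class (R1 n) x2 \<otimes>\<^bsub>G1 n\<^esub> word_class (R1 n) x2 = \<one>\<^bsub>G1 n\<^esub>"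
      using one[of x2] by simp
    show "word_class (R1 n) x2 \<otimes>\<^bsub>G1 n\<^esub> word_class (R1 n) u \<otimes>\<^bsub>G1 n\<^esub>
        (word_class (R1 n) x2 \<otimes>\<^bsub>G1 n\<^esub> word_class (R1 n) u) = \<one>\<^bsub>G1 n\<^esub>"
      using one[of "x2 @ u"] that by auto
  qed simp_all
  show ?thesis
  proof unfold_locales
    show "carrier (G1 n) = generate (G1 n)
        {word_class (R1 n) x0, word_class (R1 n) x1, word_class (R1 n) x2}"
      by (rule presented_group_index_generated)
  qed (use one[of x0] one[of x1] one[of x2] comm[of x0] comm[of x1] in simp_all)
qed

lemma rho_pow_G1:
  "involution_pair.\<rho> (G1 n) (word_class (R1 n) x0) (word_class (R1 n) x1) [^]\<^bsub>G1 n\<^esub> n = \<one>\<^bsub>G1 n\<^esub>"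
proof -
  interpret G1: central_triple "G1 n" "word_class (R1 n) x0" "word_class (R1 n) x1" "word_class (R1 n) x2"
    by (rule central_triple_G1)
  have "word_class (R1 n) (word_power (x0 @ x1) n) = \<one>\<^bsub>G1 n\<^esub>"
    unfolding presented_one by (rule presented_relation) (simp add: R1_def)
  then show ?thesis by (simp add: G1.\<rho>_def word_class_power)
qed

lemma (in group) case_index_closed:
  "x \<in> carrier G \<Longrightarrow> y \<in> carrier G \<Longrightarrow> w \<in> carrier G \<Longrightarrow> range (case_index x y w) \<subseteq> carrier G"
  by (auto split: index.split)

text \<open>The relations hold in G, which gives a homomorphism from \<open>G1 n\<close> onto G. In
  \<open>G1 n\<close> the order of the rotation divides n, so \<open>order_le\<close> caps the group
  at 4n elements and the surjection is bijective. This serves both for the concrete model and for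
  hypermap groups.\<close>

lemma (in central_triple) marked_iso_G1:
  assumes n: "n > 0" and rho: "\<rho> [^] n = \<one>" and order: "order G = 4 * n"
  shows "marked_iso (G1 n) (word_class (R1 n) x0) (word_class (R1 n) x1) (word_class (R1 n) x2) G a b z"
proof -
  let ?f = "case_index a b z"
  have f: "range ?f \<subseteq> carrier G" by (rule case_index_closed) simp_all
  have "eval_word ?f u = eval_word ?f v" if "(u, v) \<in> R1 n" for u v
    using that rho[unfolded \<rho>_def]
    by (auto simp: R1_def eval_word_power[OF f] word_power_2 eval_letter_def z_a z_b m_assoc z_left_commute)
  from presented_group_hom[OF f this] obtain h where h: "h \<in> hom (G1 n) G"
    and eval: "\<And>u. h (word_class (R1 n) u) = eval_word ?f u" by blast
  interpret G1: central_triple "G1 n" "word_class (R1 n) x0" "word_class (R1 n) x1" "word_class (R1 n) x2"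
    by (rule central_triple_G1)
  have dvd: "G1.ord G1.\<rho> dvd n" using rho_pow_G1[of n] by (simp add: G1.pow_eq_id)
  then have pos: "G1.ord G1.\<rho> > 0" using n by (auto intro!: Nat.gr0I)
  have "h \<in> iso (G1 n) G"
  proof (rule hom_is_iso_if_order_le[OF G1.is_group is_group h])
    show "{word_class (R1 n) x0, word_class (R1 n) x1, word_class (R1 n) x2} \<subseteq> carrier (G1 n)" by simp
    show "carrier G = generate G (h ` {word_class (R1 n) x0, word_class (R1 n) x1, word_class (R1 n) x2})"
      by (simp add: eval eval_letter_def flip: generated)
    show "finite (carrier (G1 n))" using pos by (rule G1.finite_if_ord_pos)
    show "order (G1 n) \<le> order G"
      using G1.order_le[OF pos] dvd_imp_le[OF dvd n] order by simp
  qed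
  then show ?thesis
    by (auto simp: marked_iso_def eval eval_letter_def intro!: bexI[of _ h])
qed

text \<open>Conjugation by \<open>a\<close> inverts w, and w is its own inverse, so the two commute;
  w also commutes with \<open>b = a \<rho>\<close> because rotations commute with each
  other.\<close>

lemma (in involution_pair) half_turn:
  fixes m :: nat
  assumes "even m" "\<rho> [^] m = \<one>"
  defines "w \<equiv> \<rho> [^] (m div 2)"
  shows "w \<otimes> w = \<one>" "w \<otimes> a = a \<otimes> w" "w \<otimes> b = b \<otimes> w" "w \<in> D"
proof -
  have w: "w \<in> R"
    using subgroup_int_pow_closed[OF subgroup_R rho_in_R, of "int (m div 2)"]
    by (simp add: w_def int_pow_int)
  show sq: "w \<otimes> w = \<one>" using assms by (auto simp: w_def nat_pow_mult mult_2 elim!: evenE)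
  then have "a \<otimes> w \<otimes> a = w" using reflect[OF w] w by (simp add: inv_equality)
  then have "a \<otimes> w \<otimes> a \<otimes> a = w \<otimes> a" by simp
  then show wa: "w \<otimes> a = a \<otimes> w" using w by (simp add: m_assoc)
  have b: "a \<otimes> \<rho> = b" by (simp add: \<rho>_def)
  have "w \<otimes> (a \<otimes> \<rho>) = a \<otimes> w \<otimes> \<rho>" using w by (simp flip: m_assoc wa)
  also have "\<dots> = a \<otimes> \<rho> \<otimes> w" using w R_commute[OF w rho_in_R] by (simp add: m_assoc)
  finally show "w \<otimes> b = b \<otimes> w" unfolding b .
  show "w \<in> D" using w D_eq by simp
qed

lemma rho_pow_G2:
  "involution_pair.\<rho> (G2 m) (word_class (R2 m) x0) (word_class (R2 m) x1) [^]\<^bsub>G2 m\<^esub> m = \<one>\<^bsub>G2 m\<^esub>"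
  and x2_G2: "word_class (R2 m) x2 =
    involution_pair.\<rho> (G2 m) (word_class (R2 m) x0) (word_class (R2 m) x1) [^]\<^bsub>G2 m\<^esub> (m div 2)"
  and involution_pair_G2: "involution_pair (G2 m) (word_class (R2 m) x0) (word_class (R2 m) x1)"
proof -
  interpret group "G2 m" by simp
  have one: "word_class (R2 m) (u @ u) = \<one>\<^bsub>G2 m\<^esub>" if "u \<in> {x0, x1}" for u
    using that presented_relation[of "word_power u 2" "[]" "R2 m"]
    by (auto simp: R2_def word_power_2 presented_one)
  show *: "involution_pair (G2 m) (word_class (R2 m) x0) (word_class (R2 m) x1)"
    by unfold_locales (use one[of x0] one[of x1] in simp_all)
  interpret G2: involution_pair "G2 m" "word_class (R2 m) x0" "word_class (R2 m) x1" by (rule *)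
  have "word_class (R2 m) (word_power (x0 @ x1) m) = \<one>\<^bsub>G2 m\<^esub>"
    unfolding presented_one by (rule presented_relation) (simp add: R2_def)
  then show "G2.\<rho> [^]\<^bsub>G2 m\<^esub> m = \<one>\<^bsub>G2 m\<^esub>" by (simp add: G2.\<rho>_def word_class_power)
  have "word_class (R2 m) x2 = word_class (R2 m) (word_power (x0 @ x1) (m div 2))"
    by (rule presented_relation) (simp add: R2_def)
  then show "word_class (R2 m) x2 = G2.\<rho> [^]\<^bsub>G2 m\<^esub> (m div 2)"
    by (simp add: G2.\<rho>_def word_class_power)
qed

lemma central_triple_G2:
  assumes "even m"
  shows "central_triple (G2 m) (word_class (R2 m) x0) (word_class (R2 m) x1) (word_class (R2 m) x2)"
proof -
  interpret G2: involution_pair "G2 m" "word_class (R2 m) x0" "word_class (R2 m) x1"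
    by (rule involution_pair_G2)
  have "central_triple_axioms (G2 m) (word_class (R2 m) x0) (word_class (R2 m) x1) (word_class (R2 m) x2)"
    using G2.half_turn[OF assms rho_pow_G2]
    by (intro central_triple_axioms.intro presented_group_index_generated)
       (simp_all only: word_class_closed flip: x2_G2)
  then show ?thesis by (intro central_triple.intro G2.involution_pair_axioms)
qed

text \<open>The argument of \<open>marked_iso_G1\<close>, except that in \<open>G2 m\<close> the
  class of \<open>x2\<close> is the half turn and lies in the dihedral subgroup, so the cap drops to
  2m.\<close>

lemma (in central_triple) marked_iso_G2:
  assumes m: "m > 0" "even m" and rho: "\<rho> [^] m = \<one>" and z: "z = \<rho> [^] (m div 2)"
    and order: "order G = 2 * m"
  shows "marked_iso (G2 m) (word_class (R2 m) x0) (word_class (R2 m) x1) (word_class (R2 m) x2) G a b z"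
proof -
  let ?f = "case_index a b z"
  have f: "range ?f \<subseteq> carrier G" by (rule case_index_closed) simp_all
  have "eval_word ?f u = eval_word ?f v" if "(u, v) \<in> R2 m" for u v
    using that
    by (auto simp: R2_def eval_word_power[OF f] word_power_2 eval_letter_def
        rho[unfolded \<rho>_def] z[unfolded \<rho>_def, symmetric])
  from presented_group_hom[OF f this] obtain h where h: "h \<in> hom (G2 m) G"
    and eval: "\<And>u. h (word_class (R2 m) u) = eval_word ?f u" by blast
  interpret G2: central_triple "G2 m" "word_class (R2 m) x0" "word_class (R2 m) x1" "word_class (R2 m) x2"
    using m(2) by (rule central_triple_G2)
  have dvd: "G2.ord G2.\<rho> dvd m" using rho_pow_G2[of m] by (simp add: G2.pow_eq_id)
  then have pos: "G2.ord G2.\<rho> > 0" using m by (auto intro!: Nat.gr0I)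
  have "word_class (R2 m) x2 \<in> G2.D"
    using G2.half_turn(4)[OF m(2) rho_pow_G2] by (simp flip: x2_G2)
  note le = G2.order_le_if_in_D[OF pos this]
  have "h \<in> iso (G2 m) G"
  proof (rule hom_is_iso_if_order_le[OF G2.is_group is_group h])
    show "{word_class (R2 m) x0, word_class (R2 m) x1, word_class (R2 m) x2} \<subseteq> carrier (G2 m)" by simp
    show "carrier G = generate G (h ` {word_class (R2 m) x0, word_class (R2 m) x1, word_class (R2 m) x2})"
      by (simp add: eval eval_letter_def flip: generated)
    show "finite (carrier (G2 m))" using pos by (rule G2.finite_if_ord_pos)
    show "order (G2 m) \<le> order G"
      using le dvd_imp_le[OF dvd m(1)] order by simp
  qed
  then show ?thesis
    by (auto simp: marked_iso_def eval eval_letter_def intro!: bexI[of _ h])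
qed

section \<open>Nondegeneracy read off from the order\<close>

lemma (in central_triple) central_hypermap_if_order_4:
  assumes n: "n \<ge> 3" and rho: "\<rho> [^] n = \<one>" and order: "order G = 4 * n"
  shows "central_hypermap G a b z" and "ord \<rho> = n" and "z \<notin> D"
proof -
  have dvd: "ord \<rho> dvd n" using rho by (simp add: pow_eq_id)
  then have pos: "ord \<rho> > 0" using n by (auto intro!: Nat.gr0I)
  have le: "ord \<rho> \<le> n" using dvd n by (auto intro: dvd_imp_le)
  \<comment> \<open>The order 4n is at most four times the order of \<open>\<rho>\<close>, which is
    at most n, so equality holds throughout. With z in \<open>D\<close> the order would be at most
    2n.\<close>
  show ord: "ord \<rho> = n" using order_le[OF pos] order le by simp
  show z: "z \<notin> D" using order_le_if_in_D[OF pos] order ord pos by auto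
  have "\<rho> \<otimes> \<rho> \<noteq> \<one>"
    using pow_eq_id[OF rho_closed, of 2] ord n by (auto simp: numeral_2_eq_2 dest: dvd_imp_le)
  moreover have "\<one> \<in> D" "\<rho> \<in> D"
    using subgroup.one_closed[OF subgroup_D] rho_in_R D_eq by auto
  then have "z \<noteq> \<one>" "\<rho> \<otimes> \<rho> \<noteq> z"
    using z subgroup.m_closed[OF subgroup_D] by auto
  ultimately show "central_hypermap G a b z" using pos by unfold_locales auto
qed

lemma (in central_triple) central_hypermap_if_order_2:
  assumes m: "m \<ge> 6" "even m" and rho: "\<rho> [^] m = \<one>" and z: "z = \<rho> [^] (m div 2)"
    and order: "order G = 2 * m"
  shows "central_hypermap G a b z" and "ord \<rho> = m"
proof -
  have dvd: "ord \<rho> dvd m" using rho by (simp add: pow_eq_id)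
  then have pos: "ord \<rho> > 0" using m by (auto intro!: Nat.gr0I)
  have le: "ord \<rho> \<le> m" using dvd m by (auto intro: dvd_imp_le)
  have "z \<in> D" using half_turn(4)[OF m(2) rho] z by simp
  then show ord: "ord \<rho> = m" using order_le_if_in_D[OF pos] order le by simp
  have "\<rho> [^] k \<noteq> \<one>" if "0 < k" "k < m" for k :: nat
    using that ord by (auto simp: pow_eq_id dest: dvd_imp_le)
  \<comment> \<open>All three exponents lie strictly between 0 and m, the last one because m is at
    least 6. They exclude that z, \<open>\<rho> \<otimes> \<rho>\<close> and their quotient are
    trivial.\<close>
  note ne = this[of "m div 2"] this[of 2] this[of "m div 2 - 2"]
  have sq: "\<rho> \<otimes> \<rho> = \<rho> [^] (2::nat)" by (simp add: numeral_2_eq_2)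
  have "2 + (m div 2 - 2) = m div 2" using m by simp
  then have "\<rho> \<otimes> \<rho> \<otimes> \<rho> [^] (m div 2 - 2) = z"
    unfolding z sq by (simp only: nat_pow_mult[OF rho_closed])
  moreover have "\<rho> [^] (m div 2 - 2) \<noteq> \<one>" using ne(3) m by simp
  ultimately have "\<rho> \<otimes> \<rho> \<noteq> z" by auto
  moreover have "z \<noteq> \<one>" "\<rho> \<otimes> \<rho> \<noteq> \<one>" using ne(1,2) m unfolding z sq by simp_all
  ultimately show "central_hypermap G a b z" using pos by unfold_locales
qed

section \<open>Dihedral models\<close>

lemma dihedral_group_simps:
  assumes "n > 0"
  shows "carrier (dihedral_group n) = {0..<int n} \<times> UNIV"
    and "\<one>\<^bsub>dihedral_group n\<^esub> = (0, False)"
    and "p \<in> carrier (dihedral_group n) \<Longrightarrow> q \<in> carrier (dihedral_group n) \<Longrightarrow>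
      p \<otimes>\<^bsub>dihedral_group n\<^esub> q =
        ((fst p + (if snd p then - fst q else fst q)) mod int n, snd p \<noteq> snd q)"
  using assms
  by (auto simp: dihedral_group_def Let_def carrier_integer_mod_group mod_add_right_eq)

lemma group_dihedral_group:
  assumes "n > 0"
  shows "group (dihedral_group n)"
proof (rule groupI)
  note simps = dihedral_group_simps[OF assms]
  let ?D = "dihedral_group n"
  show closed: "x \<otimes>\<^bsub>?D\<^esub> y \<in> carrier ?D" if "x \<in> carrier ?D" "y \<in> carrier ?D" for x y
    using simps(3)[OF that] assms by (auto simp: simps(1))
  show "\<one>\<^bsub>?D\<^esub> \<in> carrier ?D" using assms by (simp add: simps)
  show "x \<otimes>\<^bsub>?D\<^esub> y \<otimes>\<^bsub>?D\<^esub> w = x \<otimes>\<^bsub>?D\<^esub> (y \<otimes>\<^bsub>?D\<^esub> w)"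
    if "x \<in> carrier ?D" "y \<in> carrier ?D" "w \<in> carrier ?D" for x y w
    unfolding simps(3)[OF closed[OF that(1,2)] that(3)] simps(3)[OF that(1) closed[OF that(2,3)]]
    unfolding simps(3)[OF that(1,2)] simps(3)[OF that(2,3)]
    by (simp add: mod_simps algebra_simps)
  show "\<one>\<^bsub>?D\<^esub> \<otimes>\<^bsub>?D\<^esub> x = x" if "x \<in> carrier ?D" for x
    using that assms by (subst simps(3)) (auto simp: simps(1,2))
  show "\<exists>y\<in>carrier ?D. y \<otimes>\<^bsub>?D\<^esub> x = \<one>\<^bsub>?D\<^esub>" if x: "x \<in> carrier ?D" for x
  proof
    let ?y = "if snd x then x else ((- fst x) mod int n, False)"
    show y: "?y \<in> carrier ?D" using x assms by (auto simp: simps(1))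
    show "?y \<otimes>\<^bsub>?D\<^esub> x = \<one>\<^bsub>?D\<^esub>"
      by (subst simps(3)[OF y x]) (simp add: simps(2) mod_simps)
  qed
qed

lemma order_dihedral_group: "n > 0 \<Longrightarrow> order (dihedral_group n) = 2 * n"
  by (simp add: order_def dihedral_group_simps card_cartesian_product UNIV_bool)

text \<open>The second reflection is the rotation by -1 times the first; as the first inverts
  rotations, their product is the rotation by +1, which generates all rotations.\<close>

lemma dihedral_involution_pair:
  assumes "n > 0"
  defines "\<alpha> \<equiv> (0, True)" and "\<beta> \<equiv> ((- 1) mod int n, True)"
  shows "involution_pair (dihedral_group n) \<alpha> \<beta>"
    and "involution_pair.\<rho> (dihedral_group n) \<alpha> \<beta> [^]\<^bsub>dihedral_group n\<^esub> n = \<one>\<^bsub>dihedral_group n\<^esub>"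
    and "carrier (dihedral_group n) = generate (dihedral_group n) {\<alpha>, \<beta>}"
proof -
  note simps = dihedral_group_simps[OF assms(1)]
  let ?D = "dihedral_group n"
  have mem: "\<alpha> \<in> carrier ?D" "\<beta> \<in> carrier ?D" using assms by (auto simp: simps(1))
  interpret group ?D using assms(1) by (rule group_dihedral_group)
  show pair: "involution_pair ?D \<alpha> \<beta>"
    using mem by unfold_locales (simp_all add: simps(2,3) \<alpha>_def \<beta>_def mod_simps)
  interpret involution_pair ?D \<alpha> \<beta> by (rule pair)
  \<comment> \<open>The residue is written \<open>1 mod int n\<close> because for n = 1 it is
    0.\<close>
  have rho: "\<rho> = (1 mod int n, False)"
    using mem by (simp add: \<rho>_def simps(3)) (simp add: \<alpha>_def \<beta>_def mod_simps)
  have pow: "\<rho> [^]\<^bsub>?D\<^esub> k = (int k mod int n, False)" for k :: nat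
  proof (induction k)
    case 0
    then show ?case by (simp add: simps(2))
  next
    case (Suc k)
    then have "\<rho> [^]\<^bsub>?D\<^esub> Suc k = (int k mod int n, False) \<otimes>\<^bsub>?D\<^esub> \<rho>" by simp
    also have "\<dots> = (int (Suc k) mod int n, False)"
      using assms(1) rho_closed by (subst simps(3)) (auto simp: simps(1) rho mod_simps add.commute)
    finally show ?case .
  qed
  show "\<rho> [^]\<^bsub>?D\<^esub> n = \<one>\<^bsub>?D\<^esub>" by (simp add: pow simps(2))
  have "p \<in> D" if p: "p \<in> carrier ?D" for p
  proof -
    obtain c s where cs: "p = (int c, s)" "c < n"
      using p by (auto simp: simps(1)) (metis int_nat_eq nat_less_iff)
    have "\<rho> [^]\<^bsub>?D\<^esub> int c \<in> R" by (rule subgroup_int_pow_closed[OF subgroup_R rho_in_R])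
    then have c: "(int c, False) \<in> R" using pow[of c] cs by (simp add: int_pow_int)
    then have "(int c, False) \<otimes>\<^bsub>?D\<^esub> \<alpha> \<in> R #>\<^bsub>?D\<^esub> \<alpha>" by (auto simp: r_coset_def)
    moreover have "(int c, False) \<otimes>\<^bsub>?D\<^esub> \<alpha> = (int c, True)"
      using mem cs by (subst simps(3)) (auto simp: simps(1) \<alpha>_def)
    ultimately show ?thesis using c cs unfolding D_eq by (cases s) auto
  qed
  then show "carrier ?D = generate ?D {\<alpha>, \<beta>}"
    unfolding D_def[symmetric] by auto
qed

text \<open>With the half turn as a third generator the dihedral group is a central triple of order
  2m, to which \<open>marked_iso_G2\<close> applies.\<close>

lemma G2_iso_dihedral:
  assumes "m > 0" "even m"
  shows "G2 m \<cong> dihedral_group m"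
proof -
  let ?\<alpha> = "(0, True)" and ?\<beta> = "((- 1) mod int m, True)"
  note D = dihedral_involution_pair[OF assms(1)]
  interpret involution_pair "dihedral_group m" ?\<alpha> ?\<beta> by (rule D(1))
  let ?z = "\<rho> [^]\<^bsub>dihedral_group m\<^esub> (m div 2)"
  have "{?\<alpha>, ?\<beta>, ?z} \<subseteq> carrier (dihedral_group m)"
    using a_closed b_closed nat_pow_closed[OF rho_closed] by simp
  from generate_incl[OF this] mono_generate[of "{?\<alpha>, ?\<beta>}" "{?\<alpha>, ?\<beta>, ?z}"]
  have gen: "carrier (dihedral_group m) = generate (dihedral_group m) {?\<alpha>, ?\<beta>, ?z}"
    unfolding D(3) by blast
  interpret central_triple "dihedral_group m" ?\<alpha> ?\<beta> ?z
    using half_turn[OF assms(2) D(2)] by unfold_locales (simp_all flip: gen)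
  show ?thesis
    using marked_iso_G2[OF assms D(2) HOL.refl order_dihedral_group[OF assms(1)]]
    by (rule marked_iso_imp_iso)
qed

text \<open>The generator of the cyclic factor plays the part of z, and the two reflections sit in
  the other factor; the product has order 4n, as \<open>marked_iso_G1\<close> demands.\<close>

lemma G1_iso_product:
  assumes "n > 0"
  shows "G1 n \<cong> integer_mod_group 2 \<times>\<times> dihedral_group n"
proof -
  let ?\<alpha> = "(0::int, True)" and ?\<beta> = "((- 1) mod int n, True)"
  let ?D = "dihedral_group n" and ?P = "integer_mod_group 2 \<times>\<times> dihedral_group n"
  let ?a = "(0::int, ?\<alpha>)" and ?b = "(0::int, ?\<beta>)"
  note D = dihedral_involution_pair[OF assms]
  interpret D: involution_pair ?D ?\<alpha> ?\<beta> by (rule D(1))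
  let ?z = "(1::int, \<one>\<^bsub>?D\<^esub>)"
  interpret group ?P by (simp add: DirProd_group D.is_group)
  have mem: "?a \<in> carrier ?P" "?b \<in> carrier ?P" "?z \<in> carrier ?P"
    by (simp_all add: carrier_integer_mod_group)
  have "(0, d) \<in> generate ?P {?a, ?b, ?z}" if "d \<in> generate ?D {?\<alpha>, ?\<beta>}" for d
    using that
  proof (induction rule: generate.induct)
    case one
    show ?case using generate.one[of ?P] by simp
  next
    case (incl h)
    then show ?case by (auto intro!: generate.incl)
  next
    case (inv h)
    then have "inv\<^bsub>?D\<^esub> h = h" by auto
    then show ?case using inv by (auto intro!: generate.incl)
  next
    case (eng x y)
    then show ?case using generate.eng[OF eng(3,4)] by simp
  qed
  then have base: "(0, d) \<in> generate ?P {?a, ?b, ?z}" if "d \<in> carrier ?D" for d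
    using that D(3) by simp
  have "(k, d) \<in> generate ?P {?a, ?b, ?z}" if "k \<in> {0..<2}" "d \<in> carrier ?D" for k d
  proof (cases "k = 0")
    case False
    then have "(k, d) = ?z \<otimes>\<^bsub>?P\<^esub> (0, d)" using that by simp
    then show ?thesis using generate.eng[OF generate.incl base[OF that(2)], of ?z] by simp
  qed (use base that in simp)
  then have gen: "carrier ?P = generate ?P {?a, ?b, ?z}"
    using generate_incl[of "{?a, ?b, ?z}"] mem by (auto simp: carrier_integer_mod_group)
  interpret central_triple ?P ?a ?b ?z
    using mem D.a_sq D.b_sq by unfold_locales (simp_all flip: gen)
  have pow: "(0, d) [^]\<^bsub>?P\<^esub> k = (0, d [^]\<^bsub>?D\<^esub> k)" for d and k :: nat
    by (induction k) simp_all
  have "\<rho> = (0, D.\<rho>)" by (simp add: \<rho>_def D.\<rho>_def)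
  then have "\<rho> [^]\<^bsub>?P\<^esub> n = \<one>\<^bsub>?P\<^esub>" by (simp add: pow D(2))
  moreover have "order ?P = 4 * n"
    using order_dihedral_group[OF assms]
    by (simp add: order_def card_cartesian_product carrier_integer_mod_group)
  ultimately show ?thesis
    using marked_iso_G1[OF assms] by (blast intro: marked_iso_imp_iso)
qed

section \<open>Classification\<close>

text \<open>The relations only bound the order from above; that nothing collapses is seen in the
  concrete model.\<close>

lemma order_G1: "n > 0 \<Longrightarrow> order (G1 n) = 4 * n"
  using iso_order_eq[OF G1_iso_product] order_dihedral_group
  by (simp add: order_def card_cartesian_product carrier_integer_mod_group)

lemma order_G2: "m > 0 \<Longrightarrow> even m \<Longrightarrow> order (G2 m) = 2 * m"
  using iso_order_eq[OF G2_iso_dihedral] order_dihedral_group by simp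

lemma (in central_triple) central_triple_twist: "central_triple G a (b \<otimes> z) z"
proof -
  \<comment> \<open>Multiplying by z once more recovers \<open>b\<close> from the twisted
    generator.\<close>
  have "b \<otimes> z \<otimes> z \<in> generate G {a, b \<otimes> z, z}"
    by (intro generate.eng generate.incl) auto
  then have "carrier G \<subseteq> generate G {a, b \<otimes> z, z}"
    unfolding generated by (intro generate_subgroup_incl generate_is_subgroup)
       (auto simp: m_assoc intro: generate.incl)
  then have gen: "carrier G = generate G {a, b \<otimes> z, z}"
    using generate_incl[of "{a, b \<otimes> z, z}"] by simp
  show ?thesis
    by unfold_locales (simp_all add: m_assoc z_a z_b z_left_commute flip: gen)
qed

text \<open>The new rotation is \<open>\<rho> z\<close> with z central, so its n-th power is the
  n-th power of z, which is z itself for odd n. Thus z is the half turn of a rotation of doubled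
  exponent.\<close>

lemma (in central_triple) rho_twist:
  fixes n :: nat
  assumes "\<rho> [^] n = \<one>" "odd n"
  defines "\<rho>' \<equiv> involution_pair.\<rho> G a (b \<otimes> z)"
  shows "\<rho>' [^] (2 * n) = \<one>" and "\<rho>' [^] (2 * n div 2) = z"
proof -
  interpret twist: central_triple G a "b \<otimes> z" z by (rule central_triple_twist)
  have rho': "\<rho>' = \<rho> \<otimes> z" by (simp add: \<rho>'_def twist.\<rho>_def \<rho>_def m_assoc)
  obtain k where n: "n = 2 * k + 1" using assms(2) by (rule oddE)
  have "z [^] (2::nat) = \<one>" by (simp add: numeral_2_eq_2)
  then have "z [^] (2 * k) = \<one>" by (metis nat_pow_one nat_pow_pow z_closed)
  then have "z [^] n = z" by (simp add: n)
  then have pow: "\<rho>' [^] n = z"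
    using assms(1) by (simp add: rho' pow_mult_distrib z_central)
  then show "\<rho>' [^] (2 * n div 2) = z" by simp
  have "\<rho>' [^] (2 * n) = \<rho>' [^] n \<otimes> \<rho>' [^] n"
    using rho' by (simp add: nat_pow_mult mult_2)
  with pow show "\<rho>' [^] (2 * n) = \<one>" by simp
qed

lemma iso_pow_eq_one:
  assumes "group G" "group H" "G \<cong> H" "\<And>x. x \<in> carrier G \<Longrightarrow> x [^]\<^bsub>G\<^esub> (k::nat) = \<one>\<^bsub>G\<^esub>"
    and y: "y \<in> carrier H"
  shows "y [^]\<^bsub>H\<^esub> k = \<one>\<^bsub>H\<^esub>"
proof -
  obtain h where h: "h \<in> iso G H" using assms(3) by (auto simp: is_iso_def)
  then interpret group_hom G H h
    using assms(1,2) by (simp add: group_hom_def group_hom_axioms_def iso_imp_homomorphism)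
  obtain x where "x \<in> carrier G" "y = h x"
    using h y by (auto simp: iso_def bij_betw_def)
  then show ?thesis using assms(4) by (metis hom_nat_pow hom_one)
qed

context central_hypermap
begin

lemma ord_ge_3: "ord \<rho> \<ge> 3"
proof -
  have "ord \<rho> \<noteq> 1" using rho_sq(1) ord_eq_1[OF rho_closed] by auto
  moreover have "ord \<rho> \<noteq> 2" using rho_sq(1) ord_eq_2_iff[OF rho_closed] by auto
  ultimately show ?thesis using ord_pos by linarith
qed

lemma case_G1:
  assumes "z \<notin> D"
  shows "order G = 4 * ord \<rho>"
    and "marked_iso (G1 (ord \<rho>)) (word_class (R1 (ord \<rho>)) x0) (word_class (R1 (ord \<rho>)) x1)
      (word_class (R1 (ord \<rho>)) x2) G a b z"
proof -
  show *: "order G = 4 * ord \<rho>" using order_eq[OF ord_pos rho_sq(1)] assms by simp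
  show "marked_iso (G1 (ord \<rho>)) (word_class (R1 (ord \<rho>)) x0) (word_class (R1 (ord \<rho>)) x1)
      (word_class (R1 (ord \<rho>)) x2) G a b z"
    by (rule marked_iso_G1[OF ord_pos _ *]) simp
qed

lemma case_G2:
  assumes "z \<in> D"
  shows "order G = 2 * ord \<rho>" and "even (ord \<rho>)" and "ord \<rho> \<ge> 6"
    and "marked_iso (G2 (ord \<rho>)) (word_class (R2 (ord \<rho>)) x0) (word_class (R2 (ord \<rho>)) x1)
      (word_class (R2 (ord \<rho>)) x2) G a b z"
proof -
  show *: "order G = 2 * ord \<rho>" using order_eq[OF ord_pos rho_sq(1)] assms by simp
  have half: "even (ord \<rho>) \<and> z = \<rho> [^] (ord \<rho> div 2)"
    by (rule central_involution_in_D[OF ord_pos rho_sq(1) assms z_sq z_ne]) (simp add: z_central)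
  then show "even (ord \<rho>)" by simp
  \<comment> \<open>Order 4 would make z equal to \<open>\<rho> \<otimes> \<rho>\<close>, against
    nondegeneracy; an even order that is at least 3 and not 4 is at least 6.\<close>
  have "ord \<rho> \<noteq> 4"
  proof
    assume "ord \<rho> = 4"
    then have "z = \<rho> [^] (2::nat)" using half by simp
    then show False using rho_sq(2) by (simp add: numeral_2_eq_2)
  qed
  moreover obtain k where "ord \<rho> = 2 * k" using half by blast
  ultimately show "ord \<rho> \<ge> 6" using ord_ge_3 by arith
  show "marked_iso (G2 (ord \<rho>)) (word_class (R2 (ord \<rho>)) x0) (word_class (R2 (ord \<rho>)) x1)
      (word_class (R2 (ord \<rho>)) x2) G a b z"
    using half by (intro marked_iso_G2[OF ord_pos _ _ _ *]) simp_all
qed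

end

section \<open>Invariants of the three families\<close>

lemma M1_properties:
  assumes "n \<ge> 3"
  shows "on_M1 regular_linear_hypermap n" and "on_M1 orientable n"
    and "on_M1 M_sequence n = (0, (2, 2, n), (n, n, 2), 4 * n)"
proof -
  interpret central_triple "G1 n" "word_class (R1 n) x0" "word_class (R1 n) x1" "word_class (R1 n) x2"
    by (rule central_triple_G1)
  have order: "order (G1 n) = 4 * n" using assms by (simp add: order_G1)
  note ch = central_hypermap_if_order_4[OF assms rho_pow_G1 order]
  interpret central_hypermap "G1 n" "word_class (R1 n) x0" "word_class (R1 n) x1" "word_class (R1 n) x2"
    by (rule ch)
  show "on_M1 regular_linear_hypermap n" by (rule regular_linear)
  show "on_M1 orientable n" "on_M1 M_sequence n = (0, (2, 2, n), (n, n, 2), 4 * n)"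
    using M_sequence_if_order_4 order by (simp_all add: ch(2))
qed

lemma M2_central_triple: "on_M2 central_triple n"
proof -
  interpret central_triple "G1 n" "word_class (R1 n) x0" "word_class (R1 n) x1" "word_class (R1 n) x2"
    by (rule central_triple_G1)
  show ?thesis by (rule central_triple_twist)
qed

lemma M2_rho:
  assumes "odd n"
  shows "on_M2 (\<lambda>G a b z. involution_pair.\<rho> G a b [^]\<^bsub>G\<^esub> (2 * n) = \<one>\<^bsub>G\<^esub>) n"
    and "on_M2 (\<lambda>G a b z. z = involution_pair.\<rho> G a b [^]\<^bsub>G\<^esub> (2 * n div 2)) n"
proof -
  interpret central_triple "G1 n" "word_class (R1 n) x0" "word_class (R1 n) x1" "word_class (R1 n) x2"
    by (rule central_triple_G1)
  show "on_M2 (\<lambda>G a b z. involution_pair.\<rho> G a b [^]\<^bsub>G\<^esub> (2 * n) = \<one>\<^bsub>G\<^esub>) n"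
    "on_M2 (\<lambda>G a b z. z = involution_pair.\<rho> G a b [^]\<^bsub>G\<^esub> (2 * n div 2)) n"
    using rho_twist[OF rho_pow_G1 assms] by metis+
qed

text \<open>For odd n the twisted triple satisfies the relations of \<open>G2 (2 * n)\<close>, and
  4n is twice 2n, so the second family falls under the same analysis as the third. The marked
  isomorphism also supplies the isomorphism of the two groups.\<close>

lemma M2_properties:
  assumes "n \<ge> 3" "odd n"
  shows "on_M2 regular_linear_hypermap n" and "on_M2 non_orientable n"
    and "on_M2 on_projective_plane n"
    and "on_M2 M_sequence n = (1, (2, 2, 2 * n), (n, n, 1), 4 * n)"
    and "marked_iso (G2 (2 * n)) (word_class (R2 (2 * n)) x0) (word_class (R2 (2 * n)) x1)
      (word_class (R2 (2 * n)) x2) (G1 n) (word_class (R1 n) x0)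
      (word_class (R1 n) x1 \<otimes>\<^bsub>G1 n\<^esub> word_class (R1 n) x2) (word_class (R1 n) x2)"
proof -
  interpret central_triple "G1 n" "word_class (R1 n) x0"
      "word_class (R1 n) x1 \<otimes>\<^bsub>G1 n\<^esub> word_class (R1 n) x2" "word_class (R1 n) x2"
    by (rule M2_central_triple)
  have order: "order (G1 n) = 2 * (2 * n)" using assms by (simp add: order_G1)
  have "2 * n \<ge> 6" "even (2 * n)" using assms by simp_all
  note ch = central_hypermap_if_order_2[OF this M2_rho[OF assms(2)] order]
  interpret central_hypermap "G1 n" "word_class (R1 n) x0"
      "word_class (R1 n) x1 \<otimes>\<^bsub>G1 n\<^esub> word_class (R1 n) x2" "word_class (R1 n) x2"
    by (rule ch)
  show "on_M2 regular_linear_hypermap n" by (rule regular_linear)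
  have "order (G1 n) = 2 * ord \<rho>" using order ch(2) by simp
  note M = M_sequence_if_order_2[OF this]
  show "on_M2 non_orientable n" "on_M2 on_projective_plane n" by (rule M)+
  show "on_M2 M_sequence n = (1, (2, 2, 2 * n), (n, n, 1), 4 * n)"
    using M(1)[unfolded ch(2)] by simp
  show "marked_iso (G2 (2 * n)) (word_class (R2 (2 * n)) x0) (word_class (R2 (2 * n)) x1)
      (word_class (R2 (2 * n)) x2) (G1 n) (word_class (R1 n) x0)
      (word_class (R1 n) x1 \<otimes>\<^bsub>G1 n\<^esub> word_class (R1 n) x2) (word_class (R1 n) x2)"
    by (rule marked_iso_G2[OF _ _ M2_rho[OF assms(2)] order]) (use assms in simp_all)
qed

lemma M3_properties:
  assumes "m \<ge> 6" "even m"
  shows "on_M3 regular_linear_hypermap m" and "on_M3 non_orientable m"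
    and "on_M3 on_projective_plane m"
    and "on_M3 M_sequence m = (1, (2, 2, m), (m div 2, m div 2, 1), 2 * m)"
    and "group.ord (G2 m) (involution_pair.\<rho> (G2 m) (word_class (R2 m) x0) (word_class (R2 m) x1)) = m"
proof -
  interpret central_triple "G2 m" "word_class (R2 m) x0" "word_class (R2 m) x1" "word_class (R2 m) x2"
    using assms(2) by (rule central_triple_G2)
  have order: "order (G2 m) = 2 * m" using assms by (simp add: order_G2)
  note ch = central_hypermap_if_order_2[OF assms rho_pow_G2 x2_G2 order]
  interpret central_hypermap "G2 m" "word_class (R2 m) x0" "word_class (R2 m) x1" "word_class (R2 m) x2"
    by (rule ch)
  show "on_M3 regular_linear_hypermap m" by (rule regular_linear)
  show ord: "ord \<rho> = m" by (rule ch)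
  have "order (G2 m) = 2 * ord \<rho>" using order ord by simp
  note M = M_sequence_if_order_2[OF this]
  show "on_M3 non_orientable m" "on_M3 on_projective_plane m" by (rule M)+
  show "on_M3 M_sequence m = (1, (2, 2, m), (m div 2, m div 2, 1), 2 * m)"
    using M(1) by (simp add: ord)
qed

lemma G1_pow_even:
  assumes "n \<ge> 3" "even n" "x \<in> carrier (G1 n)"
  shows "x [^]\<^bsub>G1 n\<^esub> n = \<one>\<^bsub>G1 n\<^esub>"
proof -
  interpret central_triple "G1 n" "word_class (R1 n) x0" "word_class (R1 n) x1" "word_class (R1 n) x2"
    by (rule central_triple_G1)
  have "ord \<rho> = n"
    using assms by (intro central_hypermap_if_order_4 rho_pow_G1 order_G1) simp_all
  then show ?thesis using pow_even_ord_rho assms(2,3) by simp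
qed

lemma marked_iso_presented_imp_isomorphic_hypermaps:
  assumes "group G" "marked_iso (presented_group R) (word_class R u) (word_class R v) (word_class R w) G a b z"
    and "a \<in> carrier G" "b \<in> carrier G" "z \<in> carrier G"
  shows "isomorphic_hypermaps G a b z (presented_group R) (word_class R u) (word_class R v) (word_class R w)"
  using assms marked_iso_sym[OF group_presented_group _ _ _ assms(2)]
  by (simp add: marked_iso_imp_isomorphic_hypermaps)

section \<open>Hypermaps with a prescribed group\<close>

context central_hypermap
begin

lemma iso_G1_cases:
  assumes n: "n \<ge> 3" and iso: "G \<cong> G1 n"
  shows "on_M1 (isomorphic_hypermaps G a b z) n \<or> odd n \<and> on_M2 (isomorphic_hypermaps G a b z) n"
proof (cases "z \<in> D")
  case False
  have order: "order G = 4 * n" using iso_order_eq[OF iso] n by (simp add: order_G1)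
  then have ord: "ord \<rho> = n" using case_G1(1)[OF False] by simp
  have "on_M1 (isomorphic_hypermaps G a b z) n"
    using case_G1(2)[OF False, unfolded ord]
    by (rule marked_iso_presented_imp_isomorphic_hypermaps[OF is_group]) simp_all
  then show ?thesis by simp
next
  case True
  have order: "order G = 4 * n" using iso_order_eq[OF iso] n by (simp add: order_G1)
  then have ord: "ord \<rho> = 2 * n" using case_G2(1)[OF True] by simp
  \<comment> \<open>The rotation has order 2n, but for even n every element of \<open>G1 n\<close>
    is killed by the exponent n.\<close>
  have odd: "odd n"
  proof
    assume "even n"
    have "\<rho> [^] n = \<one>"
      using G1_pow_even[OF n \<open>even n\<close>] rho_closed
      by (rule iso_pow_eq_one[OF group_presented_group is_group iso_sym[OF iso]])
    then have "2 * n dvd n" using ord by (simp add: pow_eq_id)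
    then show False using n by (auto dest: dvd_imp_le)
  qed
  \<comment> \<open>Both hypermaps are marked copies of \<open>G2 (2 * n)\<close>, so they are
    compared through it.\<close>
  have "marked_iso G a b z (G2 (2 * n)) (word_class (R2 (2 * n)) x0) (word_class (R2 (2 * n)) x1)
      (word_class (R2 (2 * n)) x2)"
    using case_G2(4)[OF True] unfolding ord
    by (rule marked_iso_sym[rotated 4]) simp_all
  from marked_iso_trans[OF this M2_properties(5)[OF n odd]]
  have "on_M2 (isomorphic_hypermaps G a b z) n"
    by (rule marked_iso_imp_isomorphic_hypermaps) simp_all
  with odd show ?thesis by blast
qed

lemma iso_G2_imp_isomorphic_hypermaps:
  assumes m: "m \<ge> 6" "4 dvd m" and iso: "G \<cong> G2 m"
  shows "on_M3 (isomorphic_hypermaps G a b z) m"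
proof -
  have even: "even m" using m(2) by presburger
  have order: "order G = 2 * m" using iso_order_eq[OF iso] m even by (simp add: order_G2)
  \<comment> \<open>Otherwise \<open>\<rho>\<close> has order m/2, which is even because 4 divides
    m, so every element of G is killed by m/2; but \<open>G2 m\<close> has a rotation of order
    m.\<close>
  have "z \<in> D"
  proof (rule ccontr)
    assume "z \<notin> D"
    then have ord: "2 * ord \<rho> = m" using case_G1(1) order by simp
    then have "even (ord \<rho>)" using m(2) by presburger
    interpret G2: central_triple "G2 m" "word_class (R2 m) x0" "word_class (R2 m) x1" "word_class (R2 m) x2"
      using even by (rule central_triple_G2)
    have "G2.\<rho> [^]\<^bsub>G2 m\<^esub> ord \<rho> = \<one>\<^bsub>G2 m\<^esub>"
      using iso_pow_eq_one[OF is_group group_presented_group iso pow_even_ord_rho[OF \<open>even (ord \<rho>)\<close>] G2.rho_closed] .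
    then have "m dvd ord \<rho>"
      using M3_properties(5)[OF m(1) even] by (simp add: G2.pow_eq_id)
    then show False using ord ord_pos by (auto dest: dvd_imp_le)
  qed
  then have ord: "ord \<rho> = m" using case_G2(1) order by simp
  show ?thesis
    using case_G2(4)[OF \<open>z \<in> D\<close>, unfolded ord]
    by (rule marked_iso_presented_imp_isomorphic_hypermaps[OF is_group]) simp_all
qed

lemma iso_G1_or_G2: "(\<exists>n\<ge>3. G \<cong> G1 n) \<or> (\<exists>m\<ge>6. even m \<and> G \<cong> G2 m)"
proof (cases "z \<in> D")
  case True
  have "G \<cong> G2 (ord \<rho>)"
    using marked_iso_imp_iso[OF case_G2(4)[OF True]] by (rule group.iso_sym[OF group_presented_group])
  then show ?thesis using case_G2(2,3)[OF True] by blast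
next
  case False
  have "G \<cong> G1 (ord \<rho>)"
    using marked_iso_imp_iso[OF case_G1(2)[OF False]] by (rule group.iso_sym[OF group_presented_group])
  then show ?thesis using ord_ge_3 by blast
qed

end

lemma G1_iso_G2:
  assumes "n \<ge> 3" "odd n"
  shows "G1 n \<cong> G2 (2 * n)"
  using marked_iso_imp_iso[OF M2_properties(5)[OF assms]]
  by (rule group.iso_sym[OF group_presented_group])

lemma (in regular_linear_hypermap) Core_cases:
  "Core G (generate G {r1, r2}) = {\<one>} \<or>
    (Core G (generate G {r1, r2}) = generate G {r2} \<and>
      ((\<exists>n\<ge>3. G \<cong> G1 n) \<or> (\<exists>m\<ge>6. even m \<and> G \<cong> G2 m)))"
proof -
  have "(\<exists>n\<ge>3. G \<cong> G1 n) \<or> (\<exists>m\<ge>6. even m \<and> G \<cong> G2 m)"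
    if "Core G (generate G {r1, r2}) = generate G {r2}"
    using central_hypermap.iso_G1_or_G2[OF central_hypermap_if_Core[OF that]] .
  then show ?thesis using Core_eq by metis
qed

text \<open>The automorphism group is a copy of G, so an assumption on its isomorphism type passes
  to G.\<close>

lemma (in regular_linear_hypermap) isomorphic_if_Core:
  assumes Core: "Core G (generate G {r1, r2}) = generate G {r2}"
  shows "n \<ge> 3 \<Longrightarrow> hypermap_Aut G r0 r1 r2 \<cong> G1 n \<Longrightarrow>
      on_M1 (isomorphic_hypermaps G r0 r1 r2) n \<or>
      odd n \<and> on_M2 (isomorphic_hypermaps G r0 r1 r2) n"
    and "m \<ge> 6 \<Longrightarrow> 4 dvd m \<Longrightarrow> hypermap_Aut G r0 r1 r2 \<cong> G2 m \<Longrightarrow>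
      on_M3 (isomorphic_hypermaps G r0 r1 r2) m"
proof -
  interpret central_hypermap G r0 r1 r2 using Core by (rule central_hypermap_if_Core)
  show "n \<ge> 3 \<Longrightarrow> hypermap_Aut G r0 r1 r2 \<cong> G1 n \<Longrightarrow>
      on_M1 (isomorphic_hypermaps G r0 r1 r2) n \<or>
      odd n \<and> on_M2 (isomorphic_hypermaps G r0 r1 r2) n"
    using iso_G1_cases iso_trans[OF iso_hypermap_Aut] by blast
  show "m \<ge> 6 \<Longrightarrow> 4 dvd m \<Longrightarrow> hypermap_Aut G r0 r1 r2 \<cong> G2 m \<Longrightarrow>
      on_M3 (isomorphic_hypermaps G r0 r1 r2) m"
    using iso_G2_imp_isomorphic_hypermaps iso_trans[OF iso_hypermap_Aut] by blast
qed

theorem theorem3p10: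
  fixes G :: "('a, 'b) monoid_scheme" and r0 r1 r2 :: 'a
  shows
    "(regular_linear_hypermap G r0 r1 r2 \<longrightarrow>
        Core G (generate G {r1, r2}) = {\<one>\<^bsub>G\<^esub>} \<or>
        (Core G (generate G {r1, r2}) = generate G {r2} \<and>
          ((\<exists>n\<ge>3. G \<cong> G1 n) \<or> (\<exists>m\<ge>6. even m \<and> G \<cong> G2 m)))) \<and>
     (\<forall>n\<ge>3. G1 n \<cong> integer_mod_group 2 \<times>\<times> dihedral_group n) \<and>
     (\<forall>m\<ge>6. even m \<longrightarrow> G2 m \<cong> dihedral_group m) \<and>
     (\<forall>n\<ge>3. \<forall>m. 2 * n = m \<and> odd n \<longrightarrow> G1 n \<cong> G2 m) \<and>
     (regular_linear_hypermap G r0 r1 r2 \<and> Core G (generate G {r1, r2}) = generate G {r2} \<longrightarrow>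
        (\<forall>n\<ge>3. even n \<and> hypermap_Aut G r0 r1 r2 \<cong> G1 n \<longrightarrow>
           on_M1 (isomorphic_hypermaps G r0 r1 r2) n) \<and>
        (\<forall>n\<ge>3. odd n \<and> hypermap_Aut G r0 r1 r2 \<cong> G1 n \<longrightarrow>
           on_M1 (isomorphic_hypermaps G r0 r1 r2) n \<or> on_M2 (isomorphic_hypermaps G r0 r1 r2) n) \<and>
        (\<forall>m\<ge>6. 4 dvd m \<and> hypermap_Aut G r0 r1 r2 \<cong> G2 m \<longrightarrow>
           on_M3 (isomorphic_hypermaps G r0 r1 r2) m)) \<and>
     (\<forall>n\<ge>3. even n \<longrightarrow>
        on_M1 regular_linear_hypermap n \<and> on_M1 orientable n \<and>
        on_M1 M_sequence n = (0, (2, 2, n), (n, n, 2), 4 * n)) \<and>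
     (\<forall>n\<ge>3. odd n \<longrightarrow>
        on_M1 regular_linear_hypermap n \<and> on_M2 regular_linear_hypermap n \<and>
        on_M1 M_sequence n = (0, (2, 2, n), (n, n, 2), 4 * n) \<and>
        on_M2 M_sequence n = (1, (2, 2, 2 * n), (n, n, 1), 4 * n) \<and>
        on_M2 non_orientable n \<and> on_M2 on_projective_plane n) \<and>
     (\<forall>m\<ge>6. even m \<longrightarrow>
        on_M3 regular_linear_hypermap m \<and> on_M3 non_orientable m \<and> on_M3 on_projective_plane m \<and>
        on_M3 M_sequence m = (1, (2, 2, m), (m div 2, m div 2, 1), 2 * m))"
proof (intro conjI)
  show "regular_linear_hypermap G r0 r1 r2 \<longrightarrow>
       Core G (generate G {r1, r2}) = {\<one>\<^bsub>G\<^esub>} \<or>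
       (Core G (generate G {r1, r2}) = generate G {r2} \<and>
         ((\<exists>n\<ge>3. G \<cong> G1 n) \<or> (\<exists>m\<ge>6. even m \<and> G \<cong> G2 m)))"
    by (rule impI) (rule regular_linear_hypermap.Core_cases)
  show "\<forall>n\<ge>3. G1 n \<cong> integer_mod_group 2 \<times>\<times> dihedral_group n"
    using G1_iso_product by simp
  show "\<forall>m\<ge>6. even m \<longrightarrow> G2 m \<cong> dihedral_group m"
    using G2_iso_dihedral by simp
  show "\<forall>n\<ge>3. \<forall>m. 2 * n = m \<and> odd n \<longrightarrow> G1 n \<cong> G2 m"
    using G1_iso_G2 by blast
  show "regular_linear_hypermap G r0 r1 r2 \<and> Core G (generate G {r1, r2}) = generate G {r2} \<longrightarrow>
       (\<forall>n\<ge>3. even n \<and> hypermap_Aut G r0 r1 r2 \<cong> G1 n \<longrightarrow>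
          on_M1 (isomorphic_hypermaps G r0 r1 r2) n) \<and>
       (\<forall>n\<ge>3. odd n \<and> hypermap_Aut G r0 r1 r2 \<cong> G1 n \<longrightarrow>
          on_M1 (isomorphic_hypermaps G r0 r1 r2) n \<or> on_M2 (isomorphic_hypermaps G r0 r1 r2) n) \<and>
       (\<forall>m\<ge>6. 4 dvd m \<and> hypermap_Aut G r0 r1 r2 \<cong> G2 m \<longrightarrow>
          on_M3 (isomorphic_hypermaps G r0 r1 r2) m)"
  proof (intro impI; elim conjE)
    assume M: "regular_linear_hypermap G r0 r1 r2" "Core G (generate G {r1, r2}) = generate G {r2}"
    note iso = regular_linear_hypermap.isomorphic_if_Core[OF M]
    show "(\<forall>n\<ge>3. even n \<and> hypermap_Aut G r0 r1 r2 \<cong> G1 n \<longrightarrow>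
          on_M1 (isomorphic_hypermaps G r0 r1 r2) n) \<and>
       (\<forall>n\<ge>3. odd n \<and> hypermap_Aut G r0 r1 r2 \<cong> G1 n \<longrightarrow>
          on_M1 (isomorphic_hypermaps G r0 r1 r2) n \<or> on_M2 (isomorphic_hypermaps G r0 r1 r2) n) \<and>
       (\<forall>m\<ge>6. 4 dvd m \<and> hypermap_Aut G r0 r1 r2 \<cong> G2 m \<longrightarrow>
          on_M3 (isomorphic_hypermaps G r0 r1 r2) m)"
      using iso by blast
  qed
  show "\<forall>n\<ge>3. even n \<longrightarrow>
       on_M1 regular_linear_hypermap n \<and> on_M1 orientable n \<and>
       on_M1 M_sequence n = (0, (2, 2, n), (n, n, 2), 4 * n)"
    using M1_properties by simp
  show "\<forall>n\<ge>3. odd n \<longrightarrow>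
       on_M1 regular_linear_hypermap n \<and> on_M2 regular_linear_hypermap n \<and>
       on_M1 M_sequence n = (0, (2, 2, n), (n, n, 2), 4 * n) \<and>
       on_M2 M_sequence n = (1, (2, 2, 2 * n), (n, n, 1), 4 * n) \<and>
       on_M2 non_orientable n \<and> on_M2 on_projective_plane n"
    using M1_properties M2_properties(1-4) by simp
  show "\<forall>m\<ge>6. even m \<longrightarrow>
       on_M3 regular_linear_hypermap m \<and> on_M3 non_orientable m \<and> on_M3 on_projective_plane m \<and>
       on_M3 M_sequence m = (1, (2, 2, m), (m div 2, m div 2, 1), 2 * m)"
    using M3_properties(1-4) by simp
qed

end
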